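(* Let $X$ be a uniformly locally finite metric space. Then $\mathrm{BD}(X)=\mathcal M(\mathrm{C}^*(X))$, where the multiplier algebra $\mathcal M(\mathrm{C}^*(X))$ is identified with the idealizer \[ \{b\in\mathcal B(\ell_2(X,H))\mid ba\in\mathrm{C}^*(X)\text{ and }ab\in\mathrm{C}^*(X)\text{ for all }a\in\mathrm{C}^*(X)\}. \]
   Context: A metric space $(X,d)$ is uniformly locally finite (u.l.f.) if $\sup_{x\in X}|B_r(x)|<\infty$ for all $r>0$, where $B_r(x)$ is the closed ball of radius $r$ centered at $x$. $H$ is a separable infinite-dimensional Hilbert space. $\ell_2(X,H)$ is the Hilbert space of square-summable functions $X\to H$, and $\delta_x\otimes\eta$ is the function with value $\eta$ at $x$ and $0$ elsewhere. For $a\in\mathcal B(\ell_2(X,H))$ and $x,y\in X$, $a_{xy}\in\mathcal B(H)$ is determined by $\langle a_{xy}\xi,\eta\rangle=\langle a(\delta_x\otimes\xi),\delta_y\otimes\eta\rangle$, and $\mathrm{prop}(a)=\sup\{d(x,y)\mid a_{xy}\neq 0\}$. $\mathrm{BD}(X)$ is the norm closure of $\{a\in\mathcal B(\ell_2(X,H))\mid\mathrm{prop}(a)<\infty\}$, and the Roe algebra is $\mathrm{C}^*(X)=\{a\in \mathrm{BD}(X)\mid a_{xy}\text{ is compact for all }x,y\in X\}$. *)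

theory Defs
  imports "HOL-Analysis.Analysis"
begin

section \<open>Complex Hilbert spaces\<close>

text \<open>
  The class of complex inner product spaces extends \<^class>\<open>real_normed_vector\<close>, so that topology,
  completeness and the type of bounded real-linear maps are those of the library. The inner
  product is linear in its first argument.
\<close>

class complex_inner = real_normed_vector +
  fixes scaleC :: "complex \<Rightarrow> 'a \<Rightarrow> 'a"  (infixr \<open>*\<^sub>C\<close> 75)
    and cinner :: "'a \<Rightarrow> 'a \<Rightarrow> complex"
  assumes scaleC_add_right: "c *\<^sub>C (u + v) = c *\<^sub>C u + c *\<^sub>C v"
    and scaleC_add_left: "(c + d) *\<^sub>C u = c *\<^sub>C u + d *\<^sub>C u"
    and scaleC_scaleC: "c *\<^sub>C (d *\<^sub>C u) = (c * d) *\<^sub>C u"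
    and scaleC_of_real: "complex_of_real r *\<^sub>C u = r *\<^sub>R u"
    and cinner_commute: "cinner u v = cnj (cinner v u)"
    and cinner_add_left: "cinner (u + v) w = cinner u w + cinner v w"
    and cinner_scaleC_left: "cinner (c *\<^sub>C u) v = c * cinner u v"
    and cinner_self: "cinner u u = complex_of_real ((norm u)\<^sup>2)"

class chilbert_space = complex_inner + complete_space

lemma scaleC_one: "1 *\<^sub>C u = u"
  using scaleC_of_real[of 1 u] by simp

global_interpretation complex_vector: vector_space "scaleC :: complex \<Rightarrow> 'a \<Rightarrow> 'a::complex_inner"
  defines cspan = complex_vector.span
  by unfold_locales (simp_all add: scaleC_add_right scaleC_add_left scaleC_scaleC scaleC_one)

definition infinite_dimensional :: "'h::complex_inner itself \<Rightarrow> bool" where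
  "infinite_dimensional _ \<longleftrightarrow> \<not> (\<exists>B :: 'h set. finite B \<and> cspan B = UNIV)"

instantiation complex :: chilbert_space
begin
definition "scaleC_complex c (z::complex) = c * z"
definition "cinner_complex (z::complex) w = z * cnj w"
instance
  by standard (simp_all add: scaleC_complex_def cinner_complex_def algebra_simps scaleR_conv_of_real
      complex_mult_cnj cmod_def)
end

lemma cinner_add_right: "cinner w (u + v) = cinner w u + cinner w v"
  by (metis cinner_commute cinner_add_left complex_cnj_add)

lemma cinner_scaleC_right: "cinner u (c *\<^sub>C v) = cnj c * cinner u v"
  by (metis cinner_commute cinner_scaleC_left complex_cnj_mult complex_cnj_cnj)

lemma cinner_zero_left [simp]: "cinner 0 v = 0"
  using cinner_add_left[of 0 0 v] by simp

lemma cinner_zero_right [simp]: "cinner v 0 = 0"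
  using cinner_add_right[of v 0 0] by simp

lemma cinner_diff_left: "cinner (u - v) w = cinner u w - cinner v w"
  using cinner_add_left[of "u - v" v w] by simp

lemma cinner_diff_right: "cinner w (u - v) = cinner w u - cinner w v"
  using cinner_add_right[of w "u - v" v] by simp

lemma norm_scaleC: "norm (c *\<^sub>C u) = cmod c * norm (u::'a::complex_inner)"
proof -
  have "complex_of_real ((norm (c *\<^sub>C u))\<^sup>2) = c * cnj c * cinner u u"
    by (simp only: cinner_self[symmetric] cinner_scaleC_left cinner_scaleC_right mult_ac)
  also have "\<dots> = complex_of_real ((cmod c * norm u)\<^sup>2)"
    by (simp only: cinner_self complex_norm_square[symmetric] power_mult_distrib of_real_mult)
  finally have "(norm (c *\<^sub>C u))\<^sup>2 = (cmod c * norm u)\<^sup>2"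
    by (simp only: of_real_eq_iff)
  thus ?thesis
    by (simp add: power2_eq_iff_nonneg)
qed

lemma Re_cinner_le: "Re (cinner u v) \<le> norm u * norm (v::'a::complex_inner)"
proof -
  have "cinner (u + v) (u + v) = cinner u u + cinner v v + (cinner u v + cnj (cinner u v))"
    by (simp add: cinner_add_left cinner_add_right cinner_commute[of v u])
  hence "(norm (u + v))\<^sup>2 = (norm u)\<^sup>2 + (norm v)\<^sup>2 + 2 * Re (cinner u v)"
    unfolding cinner_self by (auto simp: complex_eq_iff)
  moreover have "(norm (u + v))\<^sup>2 \<le> (norm u + norm v)\<^sup>2"
    by (simp add: norm_triangle_ineq power_mono)
  ultimately show ?thesis
    by (simp add: power2_sum)
qed

lemma cinner_Cauchy_Schwarz: "cmod (cinner u v) \<le> norm u * norm (v::'a::complex_inner)"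
proof (cases "cinner u v = 0")
  case False
  define c where "c = cnj (sgn (cinner u v))"
  have c: "cmod c = 1"
    using False by (simp add: c_def norm_sgn)
  have "cinner (c *\<^sub>C u) v = of_real (cmod (cinner u v))"
    using False unfolding c_def cinner_scaleC_left
    by (simp add: sgn_div_norm scaleR_conv_of_real field_simps complex_norm_square[symmetric] power2_eq_square)
  hence "cmod (cinner u v) \<le> norm (c *\<^sub>C u) * norm v"
    using Re_cinner_le[of "c *\<^sub>C u" v] by simp
  thus ?thesis
    by (simp add: norm_scaleC c)
qed simp

lemma cinner_left_eqI:
  fixes u v :: "'a::complex_inner"
  assumes "\<And>w. cinner u w = cinner v w"
  shows "u = v"
proof -
  have "cinner (u - v) (u - v) = 0"
    by (simp add: cinner_diff_left assms)
  thus ?thesis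
    by (simp add: cinner_self)
qed


section \<open>Square-summable functions\<close>

typedef (overloaded) ('x, 'h::complex_inner) ell2 =
  "{f :: 'x \<Rightarrow> 'h. (\<lambda>x. (norm (f x))\<^sup>2) summable_on UNIV}"
  morphisms ell2_fun Abs_ell2
  by (rule exI[of _ "\<lambda>_. 0"]) simp

setup_lifting type_definition_ell2

lemma sq_summable_bound:
  fixes f :: "'x \<Rightarrow> 'h::real_normed_vector"
  assumes "\<And>F. finite F \<Longrightarrow> L2_set (\<lambda>x. norm (f x)) F \<le> K"
  shows "(\<lambda>x. (norm (f x))\<^sup>2) summable_on UNIV"
    and "sqrt (\<Sum>\<^sub>\<infinity>x. (norm (f x))\<^sup>2) \<le> K"
proof -
  have K: "0 \<le> K"
    using assms[of "{}"] by simp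
  have le: "(\<Sum>x\<in>F. (norm (f x))\<^sup>2) \<le> K\<^sup>2" if "finite F" for F
    using assms[OF that] unfolding L2_set_def by (rule sqrt_le_D)
  show s: "(\<lambda>x. (norm (f x))\<^sup>2) summable_on UNIV"
    by (rule nonneg_bdd_above_summable_on) (auto intro!: bdd_aboveI[of _ "K\<^sup>2"] le)
  show "sqrt (\<Sum>\<^sub>\<infinity>x. (norm (f x))\<^sup>2) \<le> K"
    by (rule real_le_lsqrt[OF _ infsum_le_finite_sums[OF s le]])
       (use K in \<open>auto intro!: infsum_nonneg\<close>)
qed

lemma L2_set_le_infsum:
  assumes "(\<lambda>x. (norm (f x))\<^sup>2) summable_on UNIV" "finite F"
  shows "L2_set (\<lambda>x. norm (f x)) F \<le> sqrt (\<Sum>\<^sub>\<infinity>x. (norm (f x))\<^sup>2)"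
  unfolding L2_set_def using assms
  by (intro real_sqrt_le_mono finite_sum_le_infsum) auto

lemma L2_set_add_le:
  fixes f g :: "'x \<Rightarrow> 'h::real_normed_vector"
  assumes "(\<lambda>x. (norm (f x))\<^sup>2) summable_on UNIV" "(\<lambda>x. (norm (g x))\<^sup>2) summable_on UNIV" "finite F"
  shows "L2_set (\<lambda>x. norm (f x + g x)) F
    \<le> sqrt (\<Sum>\<^sub>\<infinity>x. (norm (f x))\<^sup>2) + sqrt (\<Sum>\<^sub>\<infinity>x. (norm (g x))\<^sup>2)"
proof -
  have "L2_set (\<lambda>x. norm (f x + g x)) F \<le> L2_set (\<lambda>x. norm (f x) + norm (g x)) F"
    by (rule L2_set_mono) (auto intro: norm_triangle_ineq)
  also have "\<dots> \<le> L2_set (\<lambda>x. norm (f x)) F + L2_set (\<lambda>x. norm (g x)) F"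
    by (rule L2_set_triangle_ineq)
  finally show ?thesis
    using L2_set_le_infsum[OF assms(1,3)] L2_set_le_infsum[OF assms(2,3)] by linarith
qed

lemma cinner_summable:
  fixes f g :: "'x \<Rightarrow> 'h::complex_inner"
  assumes "(\<lambda>x. (norm (f x))\<^sup>2) summable_on UNIV" "(\<lambda>x. (norm (g x))\<^sup>2) summable_on UNIV"
  shows "(\<lambda>x. cinner (f x) (g x)) summable_on UNIV"
proof (rule abs_summable_summable, rule summable_on_comparison_test)
  show "(\<lambda>x. (norm (f x))\<^sup>2 + (norm (g x))\<^sup>2) summable_on UNIV"
    using assms by (rule summable_on_add)
  fix x
  have "0 \<le> (norm (f x) - norm (g x))\<^sup>2" "0 \<le> norm (f x) * norm (g x)"
    by simp_all
  thus "norm (cinner (f x) (g x)) \<le> (norm (f x))\<^sup>2 + (norm (g x))\<^sup>2"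
    using cinner_Cauchy_Schwarz[of "f x" "g x"] unfolding power2_diff by linarith
qed simp

instantiation ell2 :: (type, complex_inner) complex_inner
begin

lift_definition zero_ell2 :: "('a, 'b) ell2" is "\<lambda>_. 0"
  by simp

lift_definition plus_ell2 :: "('a, 'b) ell2 \<Rightarrow> ('a, 'b) ell2 \<Rightarrow> ('a, 'b) ell2"
  is "\<lambda>f g x. f x + g x"
  by (rule sq_summable_bound(1), rule L2_set_add_le)

lift_definition uminus_ell2 :: "('a, 'b) ell2 \<Rightarrow> ('a, 'b) ell2" is "\<lambda>f x. - f x"
  by simp

definition "f - g = f + - (g :: ('a, 'b) ell2)"

lift_definition scaleC_ell2 :: "complex \<Rightarrow> ('a, 'b) ell2 \<Rightarrow> ('a, 'b) ell2" is "\<lambda>c f x. c *\<^sub>C f x"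
  by (simp add: norm_scaleC power_mult_distrib summable_on_cmult_right)

definition "r *\<^sub>R f = complex_of_real r *\<^sub>C (f :: ('a, 'b) ell2)"

lift_definition norm_ell2 :: "('a, 'b) ell2 \<Rightarrow> real" is "\<lambda>f. sqrt (\<Sum>\<^sub>\<infinity>x. (norm (f x))\<^sup>2)" .

lift_definition cinner_ell2 :: "('a, 'b) ell2 \<Rightarrow> ('a, 'b) ell2 \<Rightarrow> complex"
  is "\<lambda>f g. \<Sum>\<^sub>\<infinity>x. cinner (f x) (g x)" .

definition "dist f g = norm (f - g :: ('a, 'b) ell2)"

definition "sgn f = inverse (norm f) *\<^sub>R (f :: ('a, 'b) ell2)"

definition "(uniformity :: (('a, 'b) ell2 \<times> ('a, 'b) ell2) filter) =
  (INF e\<in>{0 <..}. principal {(f, g). dist f g < e})"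

definition "open (U :: ('a, 'b) ell2 set) \<longleftrightarrow>
  (\<forall>f\<in>U. \<forall>\<^sub>F (f', g) in uniformity. f' = f \<longrightarrow> g \<in> U)"

instance
proof
  fix f g h :: "('a, 'b) ell2" and r s :: real and c d :: complex
  show "f + g + h = f + (g + h)" "f + g = g + f" "0 + f = f" "- f + f = 0"
    by (transfer; simp add: add_ac)+
  show "f - g = f + - g"
    by (rule minus_ell2_def)
  show cc: "c *\<^sub>C (f + g) = c *\<^sub>C f + c *\<^sub>C g" for c f and g :: "('a, 'b) ell2"
    by transfer (simp add: scaleC_add_right)
  show cl: "(c + d) *\<^sub>C f = c *\<^sub>C f + d *\<^sub>C f" for c d and f :: "('a, 'b) ell2"
    by transfer (simp add: scaleC_add_left)
  show ca: "c *\<^sub>C d *\<^sub>C f = (c * d) *\<^sub>C f" for c d and f :: "('a, 'b) ell2"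
    by transfer (simp add: scaleC_scaleC)
  show "complex_of_real r *\<^sub>C f = r *\<^sub>R f"
    by (simp add: scaleR_ell2_def)
  show "r *\<^sub>R (f + g) = r *\<^sub>R f + r *\<^sub>R g" "(r + s) *\<^sub>R f = r *\<^sub>R f + s *\<^sub>R f"
    "r *\<^sub>R s *\<^sub>R f = (r * s) *\<^sub>R f"
    by (simp_all add: scaleR_ell2_def cc cl ca)
  show "1 *\<^sub>R f = f"
    unfolding scaleR_ell2_def by transfer (simp add: scaleC_one)
  show "dist f g = norm (f - g)" "sgn f = inverse (norm f) *\<^sub>R f"
    by (simp_all add: dist_ell2_def sgn_ell2_def)
  show "uniformity = (INF e\<in>{0 <..}. principal {(f, g). dist f (g :: ('a, 'b) ell2) < e})"
    by (rule uniformity_ell2_def)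
  show "open U \<longleftrightarrow> (\<forall>f\<in>U. \<forall>\<^sub>F (f', g) in uniformity. f' = f \<longrightarrow> g \<in> U)"
    for U :: "('a, 'b) ell2 set"
    by (rule open_ell2_def)
  show "norm f = 0 \<longleftrightarrow> f = 0"
  proof transfer
    fix f :: "'a \<Rightarrow> 'b"
    assume s: "(\<lambda>x. (norm (f x))\<^sup>2) summable_on UNIV"
    show "sqrt (\<Sum>\<^sub>\<infinity>x. (norm (f x))\<^sup>2) = 0 \<longleftrightarrow> f = (\<lambda>_. 0)"
    proof
      assume "sqrt (\<Sum>\<^sub>\<infinity>x. (norm (f x))\<^sup>2) = 0"
      hence "norm (f x) = 0" for x
        using L2_set_le_infsum[OF s, of "{x}"] by simp
      thus "f = (\<lambda>_. 0)" by auto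
    qed simp
  qed
  show "norm (f + g) \<le> norm f + norm g"
    by transfer (rule sq_summable_bound(2), rule L2_set_add_le)
  show "norm (r *\<^sub>R f) = \<bar>r\<bar> * norm f"
    unfolding scaleR_ell2_def
    by transfer (simp add: norm_scaleC power_mult_distrib infsum_cmult_right' real_sqrt_mult)
  show "cinner f g = cnj (cinner g f)"
    by transfer (subst infsum_cnj[symmetric], rule infsum_cong, rule cinner_commute)
  show "cinner (f + g) h = cinner f h + cinner g h"
    by transfer (simp add: cinner_add_left infsum_add cinner_summable)
  show "cinner (c *\<^sub>C f) g = c * cinner f g"
    by transfer (simp add: cinner_scaleC_left infsum_cmult_right')
  show "cinner f f = complex_of_real ((norm f)\<^sup>2)"
  proof transfer
    fix f :: "'a \<Rightarrow> 'b"
    assume s: "(\<lambda>x. (norm (f x))\<^sup>2) summable_on UNIV"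
    have "(\<Sum>\<^sub>\<infinity>x. complex_of_real ((norm (f x))\<^sup>2)) = complex_of_real (\<Sum>\<^sub>\<infinity>x. (norm (f x))\<^sup>2)"
      using s by (intro infsum_bounded_linear_strong bounded_linear_of_real) (simp add: summable_on_of_real del: of_real_power)
    thus "(\<Sum>\<^sub>\<infinity>x. cinner (f x) (f x)) = complex_of_real ((sqrt (\<Sum>\<^sub>\<infinity>x. (norm (f x))\<^sup>2))\<^sup>2)"
      by (simp add: cinner_self infsum_nonneg)
  qed
qed

end

lemma ell2_fun_zero: "ell2_fun 0 x = 0"
  by transfer simp

lemma ell2_fun_add: "ell2_fun (f + g) x = ell2_fun f x + ell2_fun g x"
  by transfer simp

lemma ell2_fun_diff: "ell2_fun (f - g) x = ell2_fun f x - ell2_fun g x"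
  unfolding minus_ell2_def by transfer simp

lemma ell2_fun_scaleC: "ell2_fun (c *\<^sub>C f) x = c *\<^sub>C ell2_fun f x"
  by transfer simp

lemma ell2_fun_scaleR: "ell2_fun (r *\<^sub>R f) x = r *\<^sub>R ell2_fun f x"
  by (simp add: ell2_fun_scaleC flip: scaleC_of_real)

lemma L2_set_ell2_le: "finite F \<Longrightarrow> L2_set (\<lambda>x. norm (ell2_fun f x)) F \<le> norm f"
  by transfer (rule L2_set_le_infsum)

lemma norm_ell2_fun_le: "norm (ell2_fun f x) \<le> norm f"
  using L2_set_ell2_le[of "{x}" f] by simp

instance ell2 :: (type, chilbert_space) chilbert_space
proof
  fix X :: "nat \<Rightarrow> ('a, 'b) ell2"
  assume X: "Cauchy X"
  have "Cauchy (\<lambda>n. ell2_fun (X n) x)" for x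
  proof (rule CauchyI)
    fix e :: real assume "0 < e"
    then obtain M where "\<And>m n. M \<le> m \<Longrightarrow> M \<le> n \<Longrightarrow> norm (X m - X n) < e"
      using X by (metis CauchyD)
    thus "\<exists>M. \<forall>m\<ge>M. \<forall>n\<ge>M. norm (ell2_fun (X m) x - ell2_fun (X n) x) < e"
      by (metis ell2_fun_diff norm_ell2_fun_le le_less_trans)
  qed
  hence "\<exists>l. (\<lambda>n. ell2_fun (X n) x) \<longlonglongrightarrow> l" for x
    using Cauchy_convergent convergent_def by blast
  then obtain l where l: "\<And>x. (\<lambda>n. ell2_fun (X n) x) \<longlonglongrightarrow> l x"
    by metis
  have tail: "\<exists>M. \<forall>m\<ge>M. \<forall>F. finite F \<longrightarrow> L2_set (\<lambda>x. norm (l x - ell2_fun (X m) x)) F \<le> e"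
    if "0 < e" for e
  proof -
    obtain M where M: "\<And>m n. M \<le> m \<Longrightarrow> M \<le> n \<Longrightarrow> norm (X m - X n) < e"
      using X \<open>0 < e\<close> by (metis CauchyD)
    have "L2_set (\<lambda>x. norm (l x - ell2_fun (X m) x)) F \<le> e" if "M \<le> m" "finite F" for m F
    proof (rule LIMSEQ_le_const2)
      show "(\<lambda>n. L2_set (\<lambda>x. norm (ell2_fun (X n) x - ell2_fun (X m) x)) F)
        \<longlonglongrightarrow> L2_set (\<lambda>x. norm (l x - ell2_fun (X m) x)) F"
        unfolding L2_set_def by (intro tendsto_intros l)
      have "L2_set (\<lambda>x. norm (ell2_fun (X n) x - ell2_fun (X m) x)) F \<le> e" if "M \<le> n" for n
        using L2_set_ell2_le[OF \<open>finite F\<close>, of "X n - X m"] M[OF that \<open>M \<le> m\<close>]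
        by (simp add: ell2_fun_diff)
      thus "\<exists>N. \<forall>n\<ge>N. L2_set (\<lambda>x. norm (ell2_fun (X n) x - ell2_fun (X m) x)) F \<le> e"
        by blast
    qed
    thus ?thesis by blast
  qed
  obtain M where M: "\<And>F. finite F \<Longrightarrow> L2_set (\<lambda>x. norm (l x - ell2_fun (X M) x)) F \<le> 1"
    using tail[of 1] by auto
  define D where "D = Abs_ell2 (\<lambda>x. l x - ell2_fun (X M) x)"
  define L where "L = D + X M"
  have "ell2_fun D = (\<lambda>x. l x - ell2_fun (X M) x)"
    unfolding D_def using sq_summable_bound(1)[OF M] by (simp add: Abs_ell2_inverse)
  hence L: "ell2_fun L x = l x" for x
    by (simp add: L_def ell2_fun_add)
  have "X \<longlonglongrightarrow> L"
  proof (rule metric_LIMSEQ_I)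
    fix e :: real assume "0 < e"
    then obtain N where N: "\<forall>m\<ge>N. \<forall>F. finite F \<longrightarrow> L2_set (\<lambda>x. norm (l x - ell2_fun (X m) x)) F \<le> e / 2"
      using tail[of "e / 2"] by auto
    have "norm (L - X m) \<le> e / 2" if "N \<le> m" for m
      unfolding norm_ell2.rep_eq
      by (rule sq_summable_bound(2)) (use N that in \<open>simp add: ell2_fun_diff L\<close>)
    thus "\<exists>N. \<forall>m\<ge>N. dist (X m) L < e"
      using \<open>0 < e\<close> by (metis dist_commute dist_norm field_sum_of_halves less_add_same_cancel1
          half_gt_zero le_less_trans)
  qed
  thus "convergent X"
    by (auto simp: convergent_def)
qed

text \<open>The function \<open>\<delta>\<^sub>x \<otimes> \<eta>\<close>.\<close>

lift_definition delta :: "'x \<Rightarrow> 'h::complex_inner \<Rightarrow> ('x, 'h) ell2"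
  is "\<lambda>x \<eta> z. if z = x then \<eta> else 0"
proof -
  fix x :: 'x and \<eta> :: 'h
  show "(\<lambda>z. (norm (if z = x then \<eta> else 0))\<^sup>2) summable_on UNIV"
    by (rule summable_on_cong_neutral[THEN iffD1, OF _ _ _ summable_on_finite[of "{x}" "\<lambda>_. (norm \<eta>)\<^sup>2"]])
       auto
qed

lemma cinner_delta_right: "cinner f (delta x \<eta>) = cinner (ell2_fun f x) \<eta>"
proof -
  have "cinner f (delta x \<eta>) = (\<Sum>\<^sub>\<infinity>z. cinner (ell2_fun f z) (if z = x then \<eta> else 0))"
    by transfer simp
  also have "\<dots> = (\<Sum>\<^sub>\<infinity>z\<in>{x}. cinner (ell2_fun f z) \<eta>)"
    by (rule infsum_cong_neutral) auto
  finally show ?thesis by simp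
qed

lemma delta_add: "delta x (u + v) = delta x u + delta x v"
  by transfer auto

lemma delta_scaleC: "delta x (c *\<^sub>C u) = c *\<^sub>C delta x u"
  by transfer auto

lemma norm_delta: "norm (delta x u) = norm u"
proof -
  have "complex_of_real ((norm (delta x u))\<^sup>2) = complex_of_real ((norm u)\<^sup>2)"
    by (simp only: cinner_self[symmetric] cinner_delta_right) (simp add: delta.rep_eq)
  hence "(norm (delta x u))\<^sup>2 = (norm u)\<^sup>2"
    by (simp only: of_real_eq_iff)
  thus ?thesis by simp
qed


section \<open>Bounded operators and their matrix entries\<close>

text \<open>
  Elements of \<open>\<B>(H)\<close> are the complex-linear elements of the library type of bounded real-linear
  maps; the norm on that type is the operator norm.
\<close>

definition bounded_ops :: "('h::complex_inner \<Rightarrow>\<^sub>L 'h) set" where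
  "bounded_ops = {a. \<forall>c v. blinfun_apply a (c *\<^sub>C v) = c *\<^sub>C blinfun_apply a v}"

definition compact_op :: "('h::complex_inner \<Rightarrow>\<^sub>L 'h) \<Rightarrow> bool" where
  "compact_op a \<longleftrightarrow> compact (closure (blinfun_apply a ` cball 0 1))"

definition entry :: "(('x, 'h::complex_inner) ell2 \<Rightarrow>\<^sub>L ('x, 'h) ell2) \<Rightarrow> 'x \<Rightarrow> 'x \<Rightarrow> ('h \<Rightarrow>\<^sub>L 'h)" where
  "entry a x y = (THE b. b \<in> bounded_ops \<and>
     (\<forall>\<xi> \<eta>. cinner (blinfun_apply b \<xi>) \<eta> = cinner (blinfun_apply a (delta x \<xi>)) (delta y \<eta>)))"

lemma entry_ex1:
  fixes a :: "('x, 'h::complex_inner) ell2 \<Rightarrow>\<^sub>L ('x, 'h) ell2"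
  assumes "a \<in> bounded_ops"
  shows "\<exists>!b. b \<in> bounded_ops \<and>
     (\<forall>\<xi> \<eta>. cinner (blinfun_apply b \<xi>) \<eta> = cinner (blinfun_apply a (delta x \<xi>)) (delta y \<eta>))"
proof (rule ex_ex1I)
  have "bounded_linear (\<lambda>\<xi>. ell2_fun (blinfun_apply a (delta x \<xi>)) y)"
  proof (rule bounded_linear_intro[where K = "norm a"])
    fix u v :: 'h and r :: real
    show "ell2_fun (blinfun_apply a (delta x (u + v))) y
      = ell2_fun (blinfun_apply a (delta x u)) y + ell2_fun (blinfun_apply a (delta x v)) y"
      by (simp add: delta_add blinfun.add_right ell2_fun_add)
    show "ell2_fun (blinfun_apply a (delta x (r *\<^sub>R u))) y
      = r *\<^sub>R ell2_fun (blinfun_apply a (delta x u)) y"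
      using assms by (simp add: bounded_ops_def delta_scaleC ell2_fun_scaleC flip: scaleC_of_real)
    show "norm (ell2_fun (blinfun_apply a (delta x u)) y) \<le> norm u * norm a"
      using norm_ell2_fun_le[of "blinfun_apply a (delta x u)" y] norm_blinfun[of a "delta x u"]
      by (simp add: norm_delta mult.commute)
  qed
  then obtain b where b: "\<And>\<xi>. blinfun_apply b \<xi> = ell2_fun (blinfun_apply a (delta x \<xi>)) y"
    using bounded_linear_Blinfun_apply by metis
  have "b \<in> bounded_ops"
    using assms by (simp add: bounded_ops_def b delta_scaleC ell2_fun_scaleC)
  thus "\<exists>b. b \<in> bounded_ops \<and>
     (\<forall>\<xi> \<eta>. cinner (blinfun_apply b \<xi>) \<eta> = cinner (blinfun_apply a (delta x \<xi>)) (delta y \<eta>))"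
    using b cinner_delta_right by metis
next
  fix b b' :: "'h \<Rightarrow>\<^sub>L 'h"
  assume "b \<in> bounded_ops \<and>
     (\<forall>\<xi> \<eta>. cinner (blinfun_apply b \<xi>) \<eta> = cinner (blinfun_apply a (delta x \<xi>)) (delta y \<eta>))"
    "b' \<in> bounded_ops \<and>
     (\<forall>\<xi> \<eta>. cinner (blinfun_apply b' \<xi>) \<eta> = cinner (blinfun_apply a (delta x \<xi>)) (delta y \<eta>))"
  thus "b = b'"
    by (metis blinfun_eqI cinner_left_eqI)
qed

lemma
  assumes "a \<in> bounded_ops"
  shows entry_bounded_ops: "entry a x y \<in> bounded_ops"
    and cinner_entry:
      "cinner (blinfun_apply (entry a x y) \<xi>) \<eta> = cinner (blinfun_apply a (delta x \<xi>)) (delta y \<eta>)"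
  using theI'[OF entry_ex1[OF assms, of x y]] unfolding entry_def by auto

lemma entry_apply:
  "a \<in> bounded_ops \<Longrightarrow> blinfun_apply (entry a x y) \<xi> = ell2_fun (blinfun_apply a (delta x \<xi>)) y"
  by (rule cinner_left_eqI) (simp add: cinner_entry cinner_delta_right)


section \<open>Roe algebras\<close>

definition uniformly_locally_finite :: "'x::metric_space itself \<Rightarrow> bool" where
  "uniformly_locally_finite _ \<longleftrightarrow>
     (\<forall>r>0. \<exists>N. \<forall>x::'x. finite (cball x r) \<and> card (cball x r) \<le> N)"

text \<open>The supremum is taken in \<open>[0,\<infinity>]\<close>, so the zero operator has propagation \<open>0\<close>.\<close>

definition propagation :: "(('x::metric_space, 'h::complex_inner) ell2 \<Rightarrow>\<^sub>L ('x, 'h) ell2) \<Rightarrow> ennreal" where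
  "propagation a = (SUP (x, y) \<in> {(x, y). entry a x y \<noteq> 0}. ennreal (dist x y))"

definition band_dominated :: "(('x::metric_space, 'h::complex_inner) ell2 \<Rightarrow>\<^sub>L ('x, 'h) ell2) set" where
  "band_dominated = closure {a \<in> bounded_ops. propagation a < \<infinity>}"

definition roe_algebra :: "(('x::metric_space, 'h::complex_inner) ell2 \<Rightarrow>\<^sub>L ('x, 'h) ell2) set" where
  "roe_algebra = {a \<in> band_dominated. \<forall>x y. compact_op (entry a x y)}"

text \<open>The multiplier algebra of an operator algebra, realised as its idealizer.\<close>

definition multiplier_algebra :: "('h::complex_inner \<Rightarrow>\<^sub>L 'h) set \<Rightarrow> ('h \<Rightarrow>\<^sub>L 'h) set" where
  "multiplier_algebra A = {b \<in> bounded_ops. \<forall>a\<in>A. b o\<^sub>L a \<in> A \<and> a o\<^sub>L b \<in> A}"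

lemma closed_bounded_ops: "closed (bounded_ops :: ('h::complex_inner \<Rightarrow>\<^sub>L 'h) set)"
proof -
  have sc: "continuous_on UNIV (\<lambda>u::'h. c *\<^sub>C u)" for c
  proof -
    have "bounded_linear (\<lambda>u::'h. c *\<^sub>C u)"
      by (rule bounded_linear_intro[where K = "cmod c"])
         (simp_all add: scaleC_add_right scaleC_scaleC norm_scaleC mult.commute flip: scaleC_of_real)
    thus ?thesis
      by (rule linear_continuous_on)
  qed
  show ?thesis
    unfolding bounded_ops_def
    by (intro closed_Collect_all closed_Collect_eq continuous_on_compose2[OF sc] continuous_intros) auto
qed

lemma band_dominated_bounded_ops: "band_dominated \<subseteq> bounded_ops"
  unfolding band_dominated_def by (rule closure_minimal) (auto simp: closed_bounded_ops)

end

theory Submission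
  imports Defs
begin

text \<open>
  Band-dominated operators multiply the Roe algebra into itself because balls are finite: an entry of
  a product with an operator of finite propagation is a finite sum of products of entries, hence
  compact if one factor has compact entries, and compactness passes to norm limits
  (\<open>band_dominated_subset_multiplier_algebra\<close>).

  For the converse, a multiplier \<open>b\<close> is tested against the diagonal operators \<open>D\<close> whose diagonal
  entries are compact contractions. These lie in the Roe algebra, so \<open>D b\<close> and \<open>b D\<close> are
  band-dominated for all of them, and the task is to make this uniform in \<open>D\<close>.

  The local part is weak compactness (\<open>band_approximation_from_finite_cuts\<close>): if all \<open>b D\<close> with \<open>D\<close>
  finitely supported are \<open>e\<close>-close to operators of propagation at most \<open>r\<close>, with \<open>r\<close> independent of
  \<open>D\<close>, then so is \<open>b\<close>, as one lets \<open>D\<close> tend strongly to the identity and takes a weak limit of the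
  approximants.

  The uniformity in \<open>D\<close> is a gliding hump argument (\<open>gliding_hump\<close>). If it fails, there are bad
  operators \<open>D\<close> with finite support for every propagation bound. If their supports can be chosen
  disjoint, they add up to one diagonal operator \<open>D\<close> in the Roe algebra for which \<open>b D\<close> is not
  band-dominated, a contradiction. Choosing the supports outside a given finite set \<open>F\<close> is possible
  if the columns of \<open>b\<close> over \<open>F\<close> are band-dominated, since these columns can then be discarded. This
  last fact (\<open>column_band_dominated\<close>) is a second gliding hump, run with the products \<open>D b\<close>: a column
  that is not band-dominated has mass escaping to infinity, and disjoint finite blocks of compact
  contractions detect it.
\<close>

section \<open>Riesz representation and weak compactness\<close>

lemma norm_add_square:
  fixes u v :: "'a::complex_inner"
  shows "(norm (u + v))\<^sup>2 = (norm u)\<^sup>2 + (norm v)\<^sup>2 + 2 * Re (cinner u v)"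
proof -
  have "cinner (u + v) (u + v) = cinner u u + cinner v v + (cinner u v + cnj (cinner u v))"
    by (simp add: cinner_add_left cinner_add_right cinner_commute[of v u])
  thus ?thesis
    unfolding cinner_self by (auto simp: complex_eq_iff)
qed

lemma cinner_minus_right: "cinner u (- v) = - cinner u v"
  using cinner_diff_right[of u 0 v] by simp

lemma parallelogram_law:
  fixes u v :: "'a::complex_inner"
  shows "(norm (u + v))\<^sup>2 + (norm (u - v))\<^sup>2 = 2 * (norm u)\<^sup>2 + 2 * (norm v)\<^sup>2"
  using norm_add_square[of u v] norm_add_square[of u "- v"] by (simp add: cinner_minus_right)

lemma norm_le_if_cinner_le:
  fixes u :: "'a::complex_inner"
  assumes "\<And>v. cmod (cinner u v) \<le> M * norm v" "0 \<le> M"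
  shows "norm u \<le> M"
proof (cases "u = 0")
  case False
  have "norm u * norm u \<le> M * norm u"
    using assms(1)[of u] by (simp add: cinner_self power2_eq_square norm_mult)
  thus ?thesis using False by simp
qed (use assms in simp)

text \<open>
  The representing vector is the minimizer of \<open>\<parallel>u\<parallel>\<^sup>2 - 2 Re (f u)\<close>. The functional attains its infimum
  because the parallelogram law makes it uniformly convex, and its critical point equation is
  \<open>Re (f v) = Re \<langle>v, w\<rangle>\<close>. Replacing \<open>v\<close> by \<open>\<i> v\<close> gives the imaginary parts.
\<close>

theorem Riesz_representation:
  fixes f :: "'a::chilbert_space \<Rightarrow> complex"
  assumes add: "\<And>u v. f (u + v) = f u + f v"
    and scale: "\<And>c u. f (c *\<^sub>C u) = c * f u"
    and bound: "\<And>u. cmod (f u) \<le> M * norm u"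
  obtains w where "\<And>u. f u = cinner u w"
proof -
  have scaleR: "f (r *\<^sub>R u) = of_real r * f u" for r u
    by (metis scale scaleC_of_real)
  have bl: "bounded_linear f"
    by (rule bounded_linear_intro[where K = M])
       (simp_all add: add scaleR bound mult.commute scaleR_conv_of_real)
  define J where "J u = (norm u)\<^sup>2 - 2 * Re (f u)" for u
  have J_ge: "- M\<^sup>2 \<le> J u" for u
  proof -
    have "Re (f u) \<le> M * norm u"
      using bound[of u] complex_Re_le_cmod[of "f u"] by linarith
    moreover have "0 \<le> (norm u - M)\<^sup>2" by simp
    ultimately show ?thesis
      unfolding J_def power2_diff by (simp add: mult.commute)
  qed
  define m where "m = Inf (range J)"
  have bdd: "bdd_below (range J)"
    using J_ge by (auto intro!: bdd_belowI[of _ "- M\<^sup>2"])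
  have m_le: "m \<le> J u" for u
    unfolding m_def by (rule cInf_lower) (use bdd in auto)
  have near: "\<exists>u. J u < m + e" if "0 < e" for e
    using cInf_lessD[of "range J" "m + e"] that unfolding m_def by auto
  have "\<forall>n. \<exists>u. J u < m + 1 / real (Suc n)"
    using near by simp
  then obtain z where z: "\<And>n. J (z n) < m + 1 / real (Suc n)"
    by metis
  \<comment> \<open>Evaluating \<open>J\<close> at a midpoint, the parallelogram law makes minimizing sequences Cauchy.\<close>
  have mid: "(norm (x - y))\<^sup>2 \<le> 2 * (J x + J y) - 4 * m" for x y
  proof -
    have "J ((1/2) *\<^sub>R (x + y)) = (norm (x + y))\<^sup>2 / 4 - Re (f x) - Re (f y)"
      unfolding J_def by (simp add: scaleR add power2_eq_square add_divide_distrib)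
    thus ?thesis
      using m_le[of "(1/2) *\<^sub>R (x + y)"] parallelogram_law[of x y] unfolding J_def by argo
  qed
  have "Cauchy z"
  proof (rule CauchyI)
    fix e :: real assume e: "0 < e"
    obtain N where N: "4 / e\<^sup>2 < real (Suc N)"
      by (meson less_Suc_eq less_trans of_nat_less_iff reals_Archimedean2)
    have "norm (z i - z j) < e" if "N \<le> i" "N \<le> j" for i j
    proof -
      have "1 / real (Suc i) \<le> 1 / real (Suc N)" "1 / real (Suc j) \<le> 1 / real (Suc N)"
        using that by (simp_all add: frac_le)
      hence "(norm (z i - z j))\<^sup>2 < 4 * (1 / real (Suc N))"
        using mid[of "z i" "z j"] z[of i] z[of j] by argo
      also have "\<dots> \<le> e\<^sup>2"
        using N e by (simp add: field_simps)
      finally show ?thesis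
        using e by (simp add: power2_less_imp_less)
    qed
    thus "\<exists>N. \<forall>i\<ge>N. \<forall>j\<ge>N. norm (z i - z j) < e" by blast
  qed
  then obtain w where w: "z \<longlonglongrightarrow> w"
    using Cauchy_convergent convergent_def by blast
  have "(\<lambda>n. J (z n)) \<longlonglongrightarrow> J w"
    unfolding J_def by (intro tendsto_intros w bounded_linear.tendsto[OF bl])
  moreover have "(\<lambda>n. m + 1 / real (Suc n)) \<longlonglongrightarrow> m + 0"
    using LIMSEQ_Suc[OF lim_1_over_n] by (intro tendsto_intros) simp
  ultimately have "J w \<le> m + 0"
    by (rule LIMSEQ_le) (use z less_imp_le in blast)
  hence min: "J w \<le> J u" for u
    using m_le[of u] by simp
  have Re_eq: "Re (f v) = Re (cinner v w)" for v
  proof -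
    define s where "s = Re (cinner w v) - Re (f v)"
    define n where "n = (norm v)\<^sup>2"
    \<comment> \<open>The minimizer of \<open>t\<^sup>2 n + 2 t s\<close> is \<open>- s / n\<close>; the denominator \<open>n + 1\<close> also serves \<open>v = 0\<close>.\<close>
    define t where "t = - s / (n + 1)"
    have n: "0 \<le> n" by (simp add: n_def)
    have "cinner w (t *\<^sub>R v) = of_real t * cinner w v"
      by (simp add: cinner_scaleC_right flip: scaleC_of_real)
    hence "J (w + t *\<^sub>R v) = J w + t\<^sup>2 * n + 2 * t * s"
      unfolding J_def norm_add_square s_def n_def
      by (simp add: add scaleR power_mult_distrib algebra_simps)
    hence "0 \<le> t\<^sup>2 * n + 2 * t * s"
      using min[of "w + t *\<^sub>R v"] by simp
    also have "\<dots> = - (s\<^sup>2 * (n + 2) / (n + 1)\<^sup>2)"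
      unfolding t_def using n by (simp add: divide_simps) (simp add: power2_eq_square algebra_simps)
    finally have "s\<^sup>2 * (n + 2) / (n + 1)\<^sup>2 \<le> 0" by simp
    hence "s = 0"
      using n by (simp add: divide_le_0_iff mult_le_0_iff)
    moreover have "Re (cinner w v) = Re (cinner v w)"
      by (subst cinner_commute) simp
    ultimately show ?thesis by (simp add: s_def)
  qed
  have "f v = cinner v w" for v
    using Re_eq[of v] Re_eq[of "\<i> *\<^sub>C v"] by (simp add: complex_eq_iff scale cinner_scaleC_left)
  thus thesis by (rule that)
qed

text \<open>
  Weak operator compactness of norm balls. The matrix coefficients \<open>(u, v) \<mapsto> \<langle>T i u, v\<rangle>\<close> are points of
  a product of closed discs, which is compact by Tychonoff's theorem. A cluster point of them is
  again a bounded sesquilinear form, and by the Riesz theorem it comes from an operator. The filter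
  \<open>G\<close> plays the part of a convergent subnet, so that every closed condition on the coefficients of
  the \<open>T i\<close> is inherited by the limit.
\<close>

theorem bounded_net_weak_cluster_point:
  fixes T :: "'i \<Rightarrow> 'a::chilbert_space \<Rightarrow>\<^sub>L 'a"
  assumes F: "F \<noteq> bot" and T: "\<And>i. T i \<in> bounded_ops" and M: "\<And>i. norm (T i) \<le> M"
  obtains G L where "G \<noteq> bot" "G \<le> F" "L \<in> bounded_ops"
    "\<And>u v. ((\<lambda>i. cinner (T i u) v) \<longlongrightarrow> cinner (L u) v) G"
proof -
  define K :: "('a \<times> 'a \<Rightarrow> complex) set"
    where "K = (\<Pi>\<^sub>E p\<in>UNIV. cball 0 (M * norm (fst p) * norm (snd p)))"
  define \<Phi> where "\<Phi> i = (\<lambda>p. cinner (T i (fst p)) (snd p))" for i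
  have "compact K"
    unfolding K_def compactin_euclidean_iff[symmetric] euclidean_product_topology[symmetric] compactin_PiE
    by (simp del: compactin_euclidean_iff add: compactin_euclidean_iff[THEN iffD2])
  moreover have "\<Phi> i \<in> K" for i
  proof -
    have "cmod (cinner (T i u) v) \<le> M * norm u * norm v" for u v
    proof -
      have "norm (T i u) \<le> M * norm u"
        using norm_blinfun[of "T i" u] M[of i] by (meson mult_right_mono norm_ge_zero order_trans)
      thus ?thesis
        using cinner_Cauchy_Schwarz[of "T i u" v] by (meson mult_right_mono norm_ge_zero order_trans)
    qed
    thus ?thesis by (auto simp: K_def \<Phi>_def PiE_iff)
  qed
  ultimately obtain g where g: "g \<in> K" "inf (nhds g) (filtermap \<Phi> F) \<noteq> bot"
    unfolding compact_filter using F
    by (metis (mono_tags, lifting) eventually_filtermap filtermap_bot_iff always_eventually)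
  define G where "G = inf F (filtercomap \<Phi> (nhds g))"
  have G: "G \<noteq> bot"
  proof
    assume "G = bot"
    then obtain P Q where "eventually P F" "eventually Q (nhds g)" "\<And>i. P i \<Longrightarrow> \<not> Q (\<Phi> i)"
      unfolding G_def trivial_limit_def eventually_inf eventually_filtercomap by metis
    hence "eventually (\<lambda>h. \<not> Q h) (filtermap \<Phi> F)"
      by (auto simp: eventually_filtermap elim: eventually_mono)
    with \<open>eventually Q (nhds g)\<close> have "eventually (\<lambda>_. False) (inf (nhds g) (filtermap \<Phi> F))"
      unfolding eventually_inf by blast
    thus False using g(2) by (simp add: trivial_limit_def)
  qed
  have lim: "((\<lambda>i. cinner (T i u) v) \<longlongrightarrow> g (u, v)) G" for u v
  proof -
    have "(\<Phi> \<longlongrightarrow> g) G"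
      unfolding G_def by (rule filterlim_mono[OF filterlim_filtercomap order_refl]) simp_all
    hence "((\<lambda>i. \<Phi> i (u, v)) \<longlongrightarrow> g (u, v)) G"
      by (rule continuous_on_tendsto_compose[OF continuous_on_product_coordinates]) auto
    thus ?thesis by (simp add: \<Phi>_def)
  qed
  have g_le: "cmod (g (u, v)) \<le> M * norm u * norm v" for u v
    using g(1) by (auto simp: K_def PiE_def Pi_def dest!: spec[of _ "u"] spec[of _ "v"])
  have T': "T i (c *\<^sub>C u) = c *\<^sub>C T i u" for i c u
    using T by (simp add: bounded_ops_def)
  have g_add1: "g (u + u', v) = g (u, v) + g (u', v)" for u u' v
    by (rule tendsto_unique[OF G lim])
       (use tendsto_add[OF lim lim] in \<open>simp add: blinfun.add_right cinner_add_left\<close>)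
  have g_add2: "g (u, v + v') = g (u, v) + g (u, v')" for u v v'
    by (rule tendsto_unique[OF G lim])
       (use tendsto_add[OF lim lim] in \<open>simp add: cinner_add_right\<close>)
  have g_scale1: "g (c *\<^sub>C u, v) = c * g (u, v)" for c u v
    by (rule tendsto_unique[OF G lim])
       (use tendsto_mult_left[OF lim] in \<open>simp add: T' cinner_scaleC_left\<close>)
  have g_scale2: "g (u, c *\<^sub>C v) = cnj c * g (u, v)" for c u v
    by (rule tendsto_unique[OF G lim])
       (use tendsto_mult_left[OF lim] in \<open>simp add: cinner_scaleC_right\<close>)
  have "\<exists>w. \<forall>v. g (u, v) = cinner w v" for u
  proof -
    obtain w where "\<And>v. cnj (g (u, v)) = cinner v w"
      by (rule Riesz_representation[of "\<lambda>v. cnj (g (u, v))" "M * norm u"])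
         (simp_all add: g_add2 g_scale2 g_le)
    thus ?thesis by (metis cinner_commute complex_cnj_cnj)
  qed
  then obtain w where w: "\<And>u v. g (u, v) = cinner (w u) v" by metis
  have M0: "0 \<le> M" using M norm_ge_zero order_trans by blast
  have w_scale: "w (c *\<^sub>C u) = c *\<^sub>C w u" for c u
    by (rule cinner_left_eqI) (simp add: cinner_scaleC_left g_scale1 flip: w)
  have "bounded_linear w"
  proof (rule bounded_linear_intro[where K = M])
    show "w (u + v) = w u + w v" for u v
      by (rule cinner_left_eqI) (simp add: cinner_add_left g_add1 flip: w)
    show "w (r *\<^sub>R u) = r *\<^sub>R w u" for r u
      by (metis scaleC_of_real w_scale)
    show "norm (w u) \<le> norm u * M" for u
      by (rule norm_le_if_cinner_le) (use g_le M0 in \<open>simp_all add: mult.commute flip: w\<close>)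
  qed
  then obtain L where L: "\<And>u. blinfun_apply L u = w u"
    using bounded_linear_Blinfun_apply by metis
  show thesis
  proof (rule that[OF G])
    show "G \<le> F" by (simp add: G_def)
    show "L \<in> bounded_ops" by (simp add: bounded_ops_def L w_scale)
    show "((\<lambda>i. cinner (T i u) v) \<longlongrightarrow> cinner (L u) v) G" for u v
      using lim[of u v] by (simp add: L w)
  qed
qed

section \<open>Bounded and compact operators\<close>

lemma norm_blinfun_unit: "norm u \<le> 1 \<Longrightarrow> norm (blinfun_apply b u) \<le> norm b"
  using norm_blinfun[of b u] mult_left_le[of "norm u" "norm b"] by simp

lemma norm_compose_contraction_right:
  fixes a :: "'b::real_normed_vector \<Rightarrow>\<^sub>L 'c::real_normed_vector"
  assumes "norm b \<le> 1" shows "norm (a o\<^sub>L b) \<le> norm a"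
  using norm_blinfun_compose[of a b] mult_left_le[OF assms norm_ge_zero[of a]] by linarith

lemma norm_compose_contraction_left:
  fixes a :: "'b::real_normed_vector \<Rightarrow>\<^sub>L 'c::real_normed_vector"
  assumes "norm b \<le> 1" shows "norm (b o\<^sub>L a) \<le> norm a"
  using norm_blinfun_compose[of b a] mult_left_le_one_le[OF norm_ge_zero[of a] norm_ge_zero[of b] assms]
  by linarith

lemma blinfun_compose_assoc: "(a o\<^sub>L b) o\<^sub>L c = a o\<^sub>L (b o\<^sub>L c)"
  by (rule blinfun_eqI) simp

lemma blinfun_compose_diff: "(a - b) o\<^sub>L c = (a o\<^sub>L c) - (b o\<^sub>L c)"
  "c o\<^sub>L (a - b) = (c o\<^sub>L a) - (c o\<^sub>L b)"
  by (auto intro!: blinfun_eqI simp: blinfun.diff_left blinfun.diff_right)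

lemma bounded_opsD: "a \<in> bounded_ops \<Longrightarrow> a (c *\<^sub>C u) = c *\<^sub>C a u"
  by (simp add: bounded_ops_def)

lemma bounded_ops_zero: "0 \<in> bounded_ops"
  by (simp add: bounded_ops_def complex_vector.scale_zero_right)

lemma bounded_ops_id: "id_blinfun \<in> bounded_ops"
  by (simp add: bounded_ops_def)

lemma bounded_ops_add: "a \<in> bounded_ops \<Longrightarrow> b \<in> bounded_ops \<Longrightarrow> a + b \<in> bounded_ops"
  by (simp add: bounded_ops_def blinfun.add_left scaleC_add_right)

lemma bounded_ops_compose: "a \<in> bounded_ops \<Longrightarrow> b \<in> bounded_ops \<Longrightarrow> a o\<^sub>L b \<in> bounded_ops"
  by (simp add: bounded_ops_def)

lemma compact_opI:
  assumes "compact K" "blinfun_apply a ` cball 0 1 \<subseteq> K"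
  shows "compact_op a"
proof -
  have "closure (blinfun_apply a ` cball 0 1) \<subseteq> K"
    using assms by (simp add: closure_minimal compact_imp_closed)
  thus ?thesis
    unfolding compact_op_def using compact_Int_closed[OF assms(1) closed_closure, of "blinfun_apply a ` cball 0 1"]
    by (simp only: inf.absorb2)
qed

lemma compact_opE:
  assumes "compact_op a"
  obtains K where "compact K" "blinfun_apply a ` cball 0 1 \<subseteq> K"
  using that[OF assms[unfolded compact_op_def] closure_subset] .

lemma compact_op_zero: "compact_op 0"
  by (rule compact_opI[of "{0}"]) auto

lemma compact_op_add:
  assumes "compact_op a" "compact_op b"
  shows "compact_op (a + b)"
proof -
  obtain K where K: "compact K" "blinfun_apply a ` cball 0 1 \<subseteq> K"
    by (rule compact_opE[OF assms(1)])
  obtain L where L: "compact L" "blinfun_apply b ` cball 0 1 \<subseteq> L"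
    by (rule compact_opE[OF assms(2)])
  show ?thesis
  proof (rule compact_opI[OF compact_sums[OF K(1) L(1)]])
    have "\<exists>x y. (a + b) u = x + y \<and> x \<in> K \<and> y \<in> L" if "u \<in> cball 0 1" for u
      using that K(2) L(2) blinfun.add_left[of a b u] by blast
    thus "blinfun_apply (a + b) ` cball 0 1 \<subseteq> {x + y |x y. x \<in> K \<and> y \<in> L}"
      unfolding image_subset_iff mem_Collect_eq by (intro ballI)
  qed
qed

lemma compact_op_sum:
  assumes "\<And>i. i \<in> I \<Longrightarrow> compact_op (a i)"
  shows "compact_op (\<Sum>i\<in>I. a i)"
  using assms
proof (induction I rule: infinite_finite_induct)
  case (insert i I)
  thus ?case using compact_op_add[of "a i" "sum a I"] by simp
qed (simp_all add: compact_op_zero)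

lemma compact_op_compose_left:
  assumes "compact_op k"
  shows "compact_op (b o\<^sub>L k)"
proof -
  obtain K where K: "compact K" "blinfun_apply k ` cball 0 1 \<subseteq> K"
    by (rule compact_opE[OF assms])
  have "compact (blinfun_apply b ` K)"
    by (intro compact_continuous_image K linear_continuous_on blinfun.bounded_linear_right)
  thus ?thesis
    by (rule compact_opI) (use K in auto)
qed

lemma compact_op_compose_right:
  assumes "compact_op k"
  shows "compact_op (k o\<^sub>L b)"
proof -
  obtain K where K: "compact K" "blinfun_apply k ` cball 0 1 \<subseteq> K"
    by (rule compact_opE[OF assms])
  \<comment> \<open>\<open>b\<close> maps the unit ball into the ball of radius \<open>M\<close>; adding \<open>1\<close> allows division by \<open>M\<close>.\<close>
  define M where "M = norm b + 1"
  have M: "0 < M" using norm_ge_zero[of b] unfolding M_def by linarith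
  have "k (b u) \<in> (*\<^sub>R) M ` K" if "norm u \<le> 1" for u
  proof -
    have "norm (b u) \<le> norm b"
      using that by (rule norm_blinfun_unit)
    hence "norm ((1 / M) *\<^sub>R b u) \<le> 1"
      using M by (simp add: M_def field_simps)
    hence "k ((1 / M) *\<^sub>R b u) \<in> K"
      using K(2) by (auto simp: image_subset_iff)
    moreover have "k (b u) = M *\<^sub>R k ((1 / M) *\<^sub>R b u)"
      using M by (simp add: blinfun.scaleR_right)
    ultimately show ?thesis by blast
  qed
  thus ?thesis
    by (intro compact_opI[OF compact_scaling[OF K(1), of M]]) (auto simp: image_subset_iff)
qed

text \<open>
  Compactness of the closed image amounts to total boundedness of the image, and the centres of a
  finite net for the image under a close approximant also form a net for the limit.
\<close>

lemma compact_op_limit: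
  fixes a :: "'h::chilbert_space \<Rightarrow>\<^sub>L 'h"
  assumes "\<And>e. 0 < e \<Longrightarrow> \<exists>k. compact_op k \<and> norm (a - k) \<le> e"
  shows "compact_op a"
proof -
  have "\<exists>N. finite N \<and> closure (blinfun_apply a ` cball 0 1) \<subseteq> (\<Union>x\<in>N. ball x e)" if e: "0 < e" for e
  proof -
    obtain k where k: "compact_op k" "norm (a - k) \<le> e / 4"
      using assms[of "e / 4"] e by auto
    have "compact (closure (blinfun_apply k ` cball 0 1))"
      using k(1) by (simp add: compact_op_def)
    then obtain N where N: "finite N" "closure (blinfun_apply k ` cball 0 1) \<subseteq> (\<Union>x\<in>N. ball x (e / 4))"
      using e unfolding compact_eq_totally_bounded by (meson zero_less_divide_iff zero_less_numeral)
    have "blinfun_apply a ` cball 0 1 \<subseteq> (\<Union>x\<in>N. cball x (e / 2))"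
    proof
      fix w assume "w \<in> blinfun_apply a ` cball 0 1"
      then obtain u where u: "norm u \<le> 1" "w = a u" by auto
      have "k u \<in> closure (blinfun_apply k ` cball 0 1)"
        using u closure_subset by fastforce
      then obtain x where x: "x \<in> N" "dist x (k u) < e / 4"
        using N(2) by auto
      have "dist (k u) w = norm ((a - k) u)"
        by (simp add: u dist_norm blinfun.diff_left norm_minus_commute)
      also have "\<dots> \<le> norm (a - k)"
        using u(1) by (rule norm_blinfun_unit)
      finally have "dist x w \<le> e / 2"
        using dist_triangle[of x w "k u"] x(2) k(2) by simp
      thus "w \<in> (\<Union>x\<in>N. cball x (e / 2))"
        using x(1) by auto
    qed
    moreover have "closed (\<Union>x\<in>N. cball x (e / 2))"
      using N(1) by (intro closed_UN) auto
    ultimately have "closure (blinfun_apply a ` cball 0 1) \<subseteq> (\<Union>x\<in>N. cball x (e / 2))"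
      by (rule closure_minimal)
    also have "\<dots> \<subseteq> (\<Union>x\<in>N. ball x e)"
      using e by (auto intro!: UN_mono)
    finally show ?thesis using N(1) by blast
  qed
  thus ?thesis
    unfolding compact_op_def compact_eq_totally_bounded
    by (auto simp: complete_eq_closed)
qed

definition compact_contraction :: "('h::complex_inner \<Rightarrow>\<^sub>L 'h) \<Rightarrow> bool" where
  "compact_contraction k \<longleftrightarrow> k \<in> bounded_ops \<and> compact_op k \<and> norm k \<le> 1"

lemma compact_contraction_zero: "compact_contraction 0"
  by (simp add: compact_contraction_def bounded_ops_zero compact_op_zero)

lemma rank_one_op:
  fixes w :: "'h::complex_inner"
  obtains p where "p \<in> bounded_ops" "compact_op p" "\<And>u. blinfun_apply p u = cinner u w *\<^sub>C w"
proof -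
  have bl: "bounded_linear (\<lambda>c. c *\<^sub>C w)"
    by (rule bounded_linear_intro[where K = "norm w"])
       (simp_all add: scaleC_add_left norm_scaleC scaleC_scaleC scaleR_conv_of_real flip: scaleC_of_real)
  have "bounded_linear (\<lambda>u. cinner u w *\<^sub>C w)"
  proof (rule bounded_linear_intro[where K = "norm w * norm w"])
    show "cinner (u + v) w *\<^sub>C w = cinner u w *\<^sub>C w + cinner v w *\<^sub>C w" for u v
      by (simp add: cinner_add_left scaleC_add_left)
    show "cinner (r *\<^sub>R u) w *\<^sub>C w = r *\<^sub>R cinner u w *\<^sub>C w" for r u
      by (simp add: cinner_scaleC_left scaleC_scaleC flip: scaleC_of_real)
    show "norm (cinner u w *\<^sub>C w) \<le> norm u * (norm w * norm w)" for u
      using mult_right_mono[OF cinner_Cauchy_Schwarz[of u w], of "norm w"] by (simp add: norm_scaleC mult_ac)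
  qed
  then obtain p where p: "\<And>u. blinfun_apply p u = cinner u w *\<^sub>C w"
    using bounded_linear_Blinfun_apply by metis
  have "compact ((\<lambda>c. c *\<^sub>C w) ` cball 0 (norm w))"
    by (intro compact_continuous_image linear_continuous_on bl compact_cball)
  hence "compact_op p"
  proof (rule compact_opI)
    have "cmod (cinner u w) \<le> norm w" if "norm u \<le> 1" for u
      using cinner_Cauchy_Schwarz[of u w] mult_left_le_one_le[OF norm_ge_zero norm_ge_zero that, of w]
      by linarith
    thus "p ` cball 0 1 \<subseteq> (\<lambda>c. c *\<^sub>C w) ` cball 0 (norm w)"
      by (auto simp: p)
  qed
  moreover have "p \<in> bounded_ops"
    by (simp add: bounded_ops_def p cinner_scaleC_left scaleC_scaleC)
  ultimately show thesis using p by (intro that)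
qed

text \<open>
  Orthogonal projections of finite rank, built by Gram--Schmidt: if \<open>p\<close> projects onto the span of \<open>S\<close>
  and \<open>w\<close> is the normalization of \<open>v - p v \<noteq> 0\<close>, then adding to \<open>p\<close> the projection \<open>q\<close> onto the line of
  \<open>w\<close> gives the projection onto the span of \<open>insert v S\<close>. Self-adjointness and idempotence are carried
  through the induction because they yield \<open>p w = 0\<close> and, later, \<open>\<parallel>p\<parallel> \<le> 1\<close>.
\<close>

lemma finite_set_fixed_by_projection:
  fixes S :: "'h::complex_inner set"
  assumes "finite S"
  shows "\<exists>p. p \<in> bounded_ops \<and> compact_op p \<and> (\<forall>u v. cinner (p u) v = cinner u (p v)) \<and>
    (\<forall>u. p (p u) = p u) \<and> (\<forall>v\<in>S. p v = v)"
  using assms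
proof induction
  case empty
  show ?case
    by (rule exI[of _ 0]) (simp add: bounded_ops_zero compact_op_zero)
next
  case (insert v S)
  then obtain p where p: "p \<in> bounded_ops" "compact_op p"
    "\<And>u v. cinner (p u) v = cinner u (p v)" "\<And>u. p (p u) = p u" "\<And>v. v \<in> S \<Longrightarrow> p v = v"
    by blast
  show ?case
  proof (cases "p v = v")
    case True
    thus ?thesis using p by blast
  next
    case False
    define w where "w = sgn (v - p v)"
    have w1: "cinner w w = 1"
      using False by (simp add: w_def cinner_self norm_sgn)
    have pw: "p w = 0"
      by (simp add: w_def sgn_div_norm blinfun.scaleR_right blinfun.diff_right p(4))
    obtain q where q: "q \<in> bounded_ops" "compact_op q" "\<And>u. blinfun_apply q u = cinner u w *\<^sub>C w"
      using rank_one_op by metis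
    have pq: "p (q u) = 0" for u
      by (simp add: q(3) bounded_opsD[OF p(1)] pw complex_vector.scale_zero_right)
    have qp: "q (p u) = 0" for u
      by (simp add: q(3) p(3) pw)
    have qq: "q (q u) = q u" for u
      by (simp add: q(3) cinner_scaleC_left w1)
    have sym: "cinner (q u) u' = cinner u (q u')" for u u'
      by (simp add: q(3) cinner_scaleC_left cinner_scaleC_right cinner_commute[of w u'])
    have "v - p v = norm (v - p v) *\<^sub>R w"
      using False by (simp add: w_def sgn_div_norm)
    hence "q (v - p v) = v - p v"
      by (metis blinfun.scaleR_right q(3) scaleC_one w1)
    hence qv: "q v = v - p v"
      by (simp add: blinfun.diff_right qp)
    have "(p + q) u = u" if "u \<in> S" for u
      using that qp[of u] p(5)[of u] by (simp add: blinfun.add_left)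
    thus ?thesis
      by (intro exI[of _ "p + q"])
         (auto simp: bounded_ops_add compact_op_add p q(1,2) blinfun.add_left blinfun.add_right
            cinner_add_left cinner_add_right sym pq qp qq qv)
  qed
qed

lemma projection_contraction:
  fixes p :: "'h::complex_inner \<Rightarrow>\<^sub>L 'h"
  assumes "\<And>u v. cinner (p u) v = cinner u (p v)" "\<And>u. p (p u) = p u"
  shows "norm p \<le> 1"
proof (rule norm_blinfun_bound)
  fix u
  have "(norm (p u))\<^sup>2 = cmod (cinner (p u) (p u))"
    by (simp only: cinner_self) (simp add: norm_power)
  also have "\<dots> = cmod (cinner (p u) u)"
    by (metis assms)
  also have "\<dots> \<le> norm (p u) * norm u"
    by (rule cinner_Cauchy_Schwarz)
  finally show "norm (p u) \<le> 1 * norm u"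
    by (cases "p u = 0") (simp_all add: power2_eq_square)
qed simp

text \<open>
  Directed by the finite sets they fix, these compact contractions converge strongly to the identity.
  They are the source of all the elements of the Roe algebra against which a multiplier is tested.
\<close>

lemma finite_set_fixed_by_compact_contraction:
  assumes "finite S"
  obtains p where "compact_contraction p" "\<And>v. v \<in> S \<Longrightarrow> blinfun_apply p v = v"
  using finite_set_fixed_by_projection[OF assms] projection_contraction
  unfolding compact_contraction_def by metis

section \<open>Diagonal operators and cut-offs\<close>

lemma ell2_eqI: "(\<And>x. ell2_fun f x = ell2_fun g x) \<Longrightarrow> f = g"
  by (simp add: ell2_fun_inject[symmetric] fun_eq_iff)

lemma ell2_fun_delta: "ell2_fun (delta x \<xi>) y = (if y = x then \<xi> else 0)"
  by (simp add: delta.rep_eq)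

lemma delta_zero: "delta x 0 = 0"
  by (rule ell2_eqI) (simp add: ell2_fun_delta ell2_fun_zero)

lemma norm_ell2_le:
  assumes "\<And>F. finite F \<Longrightarrow> L2_set (\<lambda>x. norm (ell2_fun f x)) F \<le> K"
  shows "norm f \<le> K"
  unfolding norm_ell2.rep_eq using assms by (rule sq_summable_bound(2))

lemma norm_ell2_mono:
  fixes f :: "('x, 'h::complex_inner) ell2" and g :: "('x, 'k::complex_inner) ell2"
  assumes "\<And>x. norm (ell2_fun f x) \<le> norm (ell2_fun g x)"
  shows "norm f \<le> norm g"
proof (rule norm_ell2_le)
  fix F :: "'x set" assume "finite F"
  have "L2_set (\<lambda>x. norm (ell2_fun f x)) F \<le> L2_set (\<lambda>x. norm (ell2_fun g x)) F"
    by (rule L2_set_mono) (use assms in auto)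
  also have "\<dots> \<le> norm g"
    using \<open>finite F\<close> by (rule L2_set_ell2_le)
  finally show "L2_set (\<lambda>x. norm (ell2_fun f x)) F \<le> norm g" .
qed

text \<open>
  \<open>diag_op k\<close> acts by \<open>k x\<close> in the fibre over \<open>x\<close>. It is an operator only if the family \<open>k\<close> is uniformly
  bounded, otherwise its value carries no information; families of contractions suffice below.
\<close>

definition diag_op :: "('x \<Rightarrow> ('h::complex_inner \<Rightarrow>\<^sub>L 'h)) \<Rightarrow> ('x, 'h) ell2 \<Rightarrow>\<^sub>L ('x, 'h) ell2" where
  "diag_op k = Blinfun (\<lambda>f. Abs_ell2 (\<lambda>x. k x (ell2_fun f x)))"

definition contractions :: "('x \<Rightarrow> ('h::complex_inner \<Rightarrow>\<^sub>L 'h)) \<Rightarrow> bool" where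
  "contractions k \<longleftrightarrow> (\<forall>x. k x \<in> bounded_ops \<and> norm (k x) \<le> 1)"

lemma contractions_if_compact:
  "(\<And>x. compact_contraction (k x)) \<Longrightarrow> contractions k"
  by (simp add: contractions_def compact_contraction_def)

lemma norm_contractions_apply_le:
  "contractions k \<Longrightarrow> norm (blinfun_apply (k x) u) \<le> norm u"
  using norm_blinfun[of "k x" u] mult_left_le_one_le[of "norm u" "norm (k x)"]
  by (force simp: contractions_def)

lemma
  fixes k :: "'x \<Rightarrow> ('h::complex_inner \<Rightarrow>\<^sub>L 'h)"
  assumes k: "contractions k"
  shows ell2_fun_diag_op: "ell2_fun (diag_op k f) x = k x (ell2_fun f x)"
    and diag_op_bounded_ops: "diag_op k \<in> bounded_ops"
    and norm_diag_op_apply_le: "norm (diag_op k f) \<le> norm f"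
    and norm_diag_op_le: "norm (diag_op k) \<le> 1"
proof -
  define D where "D = (\<lambda>f :: ('x, 'h) ell2. Abs_ell2 (\<lambda>x. k x (ell2_fun f x)))"
  have D: "ell2_fun (D f) x = k x (ell2_fun f x)" for f x
  proof -
    have "L2_set (\<lambda>x. norm (k x (ell2_fun f x))) F \<le> norm f" if "finite F" for F
    proof -
      have "L2_set (\<lambda>x. norm (k x (ell2_fun f x))) F \<le> L2_set (\<lambda>x. norm (ell2_fun f x)) F"
        by (rule L2_set_mono) (use k in \<open>auto simp: norm_contractions_apply_le\<close>)
      thus ?thesis
        using L2_set_ell2_le[OF that, of f] by linarith
    qed
    hence "(\<lambda>x. (norm (k x (ell2_fun f x)))\<^sup>2) summable_on UNIV"
      by (rule sq_summable_bound(1))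
    thus ?thesis by (simp add: D_def Abs_ell2_inverse)
  qed
  have norm_D: "norm (D f) \<le> norm f" for f
    by (rule norm_ell2_mono) (simp add: D norm_contractions_apply_le[OF k])
  have "bounded_linear D"
    by (rule bounded_linear_intro[where K = 1])
       (auto intro!: ell2_eqI simp: D norm_D ell2_fun_add ell2_fun_scaleR blinfun.add_right blinfun.scaleR_right)
  hence diag: "blinfun_apply (diag_op k) = D"
    by (simp add: diag_op_def bounded_linear_Blinfun_apply flip: D_def)
  show "ell2_fun (diag_op k f) x = k x (ell2_fun f x)"
    by (simp add: diag D)
  have "blinfun_apply (k x) (c *\<^sub>C u) = c *\<^sub>C k x u" for x c u
    using k by (simp add: contractions_def bounded_opsD)
  thus "diag_op k \<in> bounded_ops"
    by (auto simp: bounded_ops_def diag D ell2_fun_scaleC intro!: ell2_eqI)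
  show "norm (diag_op k f) \<le> norm f"
    by (simp add: diag norm_D)
  show "norm (diag_op k) \<le> 1"
    by (rule norm_blinfun_bound) (simp_all add: diag norm_D)
qed

lemma diag_op_delta: "contractions k \<Longrightarrow> diag_op k (delta x \<xi>) = delta x (k x \<xi>)"
  by (rule ell2_eqI) (simp add: ell2_fun_diag_op ell2_fun_delta)

definition cut :: "'x set \<Rightarrow> ('x \<Rightarrow> ('h::complex_inner \<Rightarrow>\<^sub>L 'h)) \<Rightarrow> 'x \<Rightarrow> ('h \<Rightarrow>\<^sub>L 'h)" where
  "cut A k x = (if x \<in> A then k x else 0)"

definition restr :: "'x set \<Rightarrow> ('x, 'h::complex_inner) ell2 \<Rightarrow>\<^sub>L ('x, 'h) ell2" where
  "restr A = diag_op (cut A (\<lambda>_. id_blinfun))"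

lemma contractions_cut: "contractions k \<Longrightarrow> contractions (cut A k)"
  by (simp add: contractions_def cut_def bounded_ops_zero)

lemma contractions_id: "contractions (\<lambda>_. id_blinfun)"
  by (simp add: contractions_def bounded_ops_id norm_blinfun_id_le)

lemma ell2_fun_restr: "ell2_fun (restr A f) x = (if x \<in> A then ell2_fun f x else 0)"
  by (simp add: restr_def ell2_fun_diag_op contractions_cut contractions_id) (simp add: cut_def)

lemma restr_bounded_ops: "restr A \<in> bounded_ops"
  by (simp add: restr_def diag_op_bounded_ops contractions_cut contractions_id)

lemma norm_restr_le: "norm (restr A) \<le> 1"
  by (simp add: restr_def norm_diag_op_le contractions_cut contractions_id)

lemma restr_diag_op:
  assumes "contractions k"
  shows "restr A o\<^sub>L diag_op k = diag_op (cut A k)" "diag_op k o\<^sub>L restr A = diag_op (cut A k)"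
  using assms contractions_cut[OF assms, of A]
  by (auto intro!: blinfun_eqI ell2_eqI simp: ell2_fun_restr ell2_fun_diag_op) (auto simp: cut_def)

lemma restr_Un_disjoint: "A \<inter> B = {} \<Longrightarrow> restr (A \<union> B) = restr A + restr B"
  by (rule blinfun_eqI, rule ell2_eqI) (auto simp: blinfun.add_left ell2_fun_add ell2_fun_restr)

lemma restr_empty: "restr {} = 0"
  by (rule blinfun_eqI, rule ell2_eqI) (simp add: ell2_fun_restr ell2_fun_zero)

lemma restr_delta: "restr A (delta x \<xi>) = (if x \<in> A then delta x \<xi> else 0)"
  by (rule ell2_eqI) (auto simp: ell2_fun_restr ell2_fun_delta ell2_fun_zero)

lemma restr_singleton: "restr {x} f = delta x (ell2_fun f x)"
  by (rule ell2_eqI) (auto simp: ell2_fun_restr ell2_fun_delta)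

lemma ell2_fun_sum: "ell2_fun (\<Sum>i\<in>I. f i) x = (\<Sum>i\<in>I. ell2_fun (f i) x)"
  by (induction I rule: infinite_finite_induct) (auto simp: ell2_fun_zero ell2_fun_add)

lemma restr_finite: "finite F \<Longrightarrow> restr F f = (\<Sum>x\<in>F. delta x (ell2_fun f x))"
  by (rule ell2_eqI) (simp add: ell2_fun_restr ell2_fun_sum ell2_fun_delta)

text \<open>
  Finitely supported vectors are dense; this reduces statements about all vectors to the vectors
  \<open>delta x \<xi>\<close>.
\<close>

lemma restr_tail_small:
  fixes f :: "('x, 'h::complex_inner) ell2"
  assumes "0 < e"
  obtains F where "finite F" "norm (f - restr F f) < e"
proof -
  define s where "s = (\<lambda>x. (norm (ell2_fun f x))\<^sup>2)"
  have s: "s summable_on UNIV"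
    unfolding s_def using ell2_fun by blast
  hence "(sum s \<longlongrightarrow> infsum s UNIV) (finite_subsets_at_top UNIV)"
    by (simp add: infsum_tendsto)
  hence "\<forall>\<^sub>F F in finite_subsets_at_top UNIV. dist (sum s F) (infsum s UNIV) < e\<^sup>2"
    using assms by (intro tendstoD) simp_all
  then obtain F where F: "finite F" "dist (sum s F) (infsum s UNIV) < e\<^sup>2"
    unfolding eventually_finite_subsets_at_top by blast
  have "(norm (f - restr F f))\<^sup>2 = infsum (\<lambda>x. if x \<in> F then 0 else s x) UNIV"
    unfolding norm_ell2.rep_eq
    by (simp add: infsum_nonneg) (rule infsum_cong, simp add: ell2_fun_diff ell2_fun_restr s_def)
  also have "\<dots> = infsum s (UNIV - F)"
    by (rule infsum_cong_neutral) auto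
  also have "\<dots> = infsum s UNIV - infsum s F"
    using F(1) by (intro infsum_Diff s) auto
  also have "\<dots> < e\<^sup>2"
    using F by (simp add: dist_real_def abs_less_iff)
  finally have "norm (f - restr F f) < e"
    using assms by (simp add: power2_less_imp_less)
  thus thesis using F(1) that by blast
qed

section \<open>Operators of finite propagation and their norm limits\<close>

text \<open>
  The operators of propagation at most \<open>r\<close>, with the vanishing of entries spelled out on vectors:
  this avoids the description operator in \<open>entry\<close> and the supremum in \<open>propagation\<close>.
\<close>

definition band :: "real \<Rightarrow> (('x::metric_space, 'h::complex_inner) ell2 \<Rightarrow>\<^sub>L ('x, 'h) ell2) set" where
  "band r = {a \<in> bounded_ops. \<forall>x y \<xi>. r < dist x y \<longrightarrow> ell2_fun (a (delta x \<xi>)) y = 0}"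

lemma band_bounded_ops: "a \<in> band r \<Longrightarrow> a \<in> bounded_ops"
  by (simp add: band_def)

lemma bandD: "a \<in> band r \<Longrightarrow> r < dist x y \<Longrightarrow> ell2_fun (blinfun_apply a (delta x \<xi>)) y = 0"
  by (simp add: band_def)

lemma band_mono: "a \<in> band r \<Longrightarrow> r \<le> s \<Longrightarrow> a \<in> band s"
  by (force simp: band_def)

lemma entry_eq_zero_iff:
  "a \<in> bounded_ops \<Longrightarrow> entry a x y = 0 \<longleftrightarrow> (\<forall>\<xi>. ell2_fun (blinfun_apply a (delta x \<xi>)) y = 0)"
  by (auto simp: entry_apply intro!: blinfun_eqI) (simp flip: entry_apply)

lemma finite_propagation_iff_band:
  assumes "a \<in> bounded_ops"
  shows "propagation a < \<infinity> \<longleftrightarrow> (\<exists>r. a \<in> band r)"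
proof
  assume fin: "propagation a < \<infinity>"
  have "ell2_fun (a (delta x \<xi>)) y = 0" if "enn2real (propagation a) < dist x y" for x y \<xi>
  proof (rule ccontr)
    assume "ell2_fun (a (delta x \<xi>)) y \<noteq> 0"
    hence "entry a x y \<noteq> 0"
      using entry_eq_zero_iff[OF assms] by blast
    hence "ennreal (dist x y) \<le> propagation a"
      unfolding propagation_def by (intro SUP_upper2[of "(x, y)"]) auto
    hence "enn2real (ennreal (dist x y)) \<le> enn2real (propagation a)"
      using fin by (intro enn2real_mono) auto
    thus False using that by simp
  qed
  thus "\<exists>r. a \<in> band r"
    using assms by (auto simp: band_def)
next
  assume "\<exists>r. a \<in> band r"
  then obtain r where r: "a \<in> band r" ..
  have "propagation a \<le> ennreal r"
    unfolding propagation_def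
  proof (rule SUP_least, clarify)
    fix x y assume "entry a x y \<noteq> 0"
    hence "\<not> r < dist x y"
      using bandD[OF r] entry_eq_zero_iff[OF assms] by blast
    thus "ennreal (dist x y) \<le> ennreal r"
      by (simp add: ennreal_leI)
  qed
  thus "propagation a < \<infinity>"
    using le_less_trans[OF _ ennreal_less_top] by (simp add: infinity_ennreal_def)
qed

lemma band_dominated_iff:
  fixes a :: "('x::metric_space, 'h::complex_inner) ell2 \<Rightarrow>\<^sub>L ('x, 'h) ell2"
  shows "a \<in> band_dominated \<longleftrightarrow> a \<in> bounded_ops \<and> (\<forall>e>0. \<exists>r. \<exists>c\<in>band r. norm (a - c) < e)"
proof -
  have "{a \<in> bounded_ops. propagation a < \<infinity>} = (\<Union>r. band r :: (('x, 'h) ell2 \<Rightarrow>\<^sub>L ('x, 'h) ell2) set)"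
    using finite_propagation_iff_band band_bounded_ops by blast
  hence eq: "band_dominated = closure (\<Union>r. band r :: (('x, 'h) ell2 \<Rightarrow>\<^sub>L ('x, 'h) ell2) set)"
    by (simp only: band_dominated_def)
  have "a \<in> band_dominated \<longleftrightarrow> (\<forall>e>0. \<exists>c\<in>(\<Union>r. band r). dist c a < e)"
    by (subst eq, rule closure_approachable)
  hence "a \<in> band_dominated \<longleftrightarrow> (\<forall>e>0. \<exists>r. \<exists>c\<in>band r. norm (a - c) < e)"
    unfolding dist_norm norm_minus_commute[of _ a] by blast
  thus ?thesis using band_dominated_bounded_ops by blast
qed

lemma band_subset_band_dominated: "a \<in> band r \<Longrightarrow> a \<in> band_dominated"
  unfolding band_dominated_iff using band_bounded_ops by force

lemma band_add: "a \<in> band r \<Longrightarrow> b \<in> band r \<Longrightarrow> a + b \<in> band r"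
  by (simp add: band_def bounded_ops_add blinfun.add_left ell2_fun_add)

lemma band_dominated_add:
  assumes "a \<in> band_dominated" "b \<in> band_dominated"
  shows "a + b \<in> band_dominated"
  unfolding band_dominated_iff
proof (intro conjI allI impI)
  show "a + b \<in> bounded_ops"
    using assms by (simp add: band_dominated_iff bounded_ops_add)
  fix e :: real assume "0 < e"
  hence "0 < e / 2" by simp
  then obtain r s c d where *: "c \<in> band r" "norm (a - c) < e / 2" "d \<in> band s" "norm (b - d) < e / 2"
    using assms unfolding band_dominated_iff by meson
  have "c + d \<in> band (max r s)"
    using *(1,3) by (intro band_add) (auto elim!: band_mono)
  moreover have "norm (a + b - (c + d)) < e"
    using norm_triangle_ineq[of "a - c" "b - d"] *(2,4) by (simp add: algebra_simps)
  ultimately show "\<exists>r. \<exists>c\<in>band r. norm (a + b - c) < e" by blast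
qed

lemma band_zero: "0 \<in> band r"
  by (simp add: band_def bounded_ops_zero ell2_fun_zero)

lemma diag_op_in_band: "contractions k \<Longrightarrow> 0 \<le> r \<Longrightarrow> diag_op k \<in> band r"
  by (auto simp: band_def diag_op_bounded_ops diag_op_delta ell2_fun_delta)

text \<open>
  A row of a finite propagation operator sees only the ball around its index. Since \<open>band\<close> speaks
  about single fibres only, \<open>f\<close> is first approximated by finitely supported vectors.
\<close>

lemma band_apply_eq_zero:
  assumes a: "a \<in> band r" and f: "\<And>x. dist x y \<le> r \<Longrightarrow> ell2_fun f x = 0"
  shows "ell2_fun (blinfun_apply a f) y = 0"
proof -
  have "norm (ell2_fun (a f) y) \<le> e" if e: "0 < e" for e
  proof -
    have pos: "0 < e / (norm a + 1)"
      using e norm_ge_zero[of a] by (intro divide_pos_pos) linarith+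
    obtain F where F: "finite F" "norm (f - restr F f) < e / (norm a + 1)"
      using restr_tail_small[OF pos, of f] by blast
    have "ell2_fun (a (delta x (ell2_fun f x))) y = 0" for x
    proof (cases "dist x y \<le> r")
      case True
      thus ?thesis by (simp add: f delta_zero blinfun.zero_right ell2_fun_zero)
    qed (use bandD[OF a] in auto)
    hence "ell2_fun (a (restr F f)) y = 0"
      by (simp add: restr_finite F blinfun.sum_right ell2_fun_sum)
    hence "norm (ell2_fun (a f) y) = norm (ell2_fun (a (f - restr F f)) y)"
      by (simp add: blinfun.diff_right ell2_fun_diff)
    also have "\<dots> \<le> norm a * norm (f - restr F f)"
      by (rule order_trans[OF norm_ell2_fun_le norm_blinfun])
    also have "\<dots> \<le> (norm a + 1) * (e / (norm a + 1))"
      using F(2) pos by (intro mult_mono) simp_all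
    also have "\<dots> = e"
      using norm_ge_zero[of a] by (simp add: add_nonneg_eq_0_iff)
    finally show ?thesis .
  qed
  hence "norm (ell2_fun (a f) y) \<le> 0"
    using field_le_epsilon[of "norm (ell2_fun (a f) y)" 0] by simp
  thus ?thesis by simp
qed

lemma band_compose:
  assumes a: "a \<in> band r" and b: "b \<in> band s"
  shows "a o\<^sub>L b \<in> band (r + s)"
proof -
  have "ell2_fun (a (b (delta x \<xi>))) y = 0" if "r + s < dist x y" for x y \<xi>
  proof (rule band_apply_eq_zero[OF a])
    fix z assume "dist z y \<le> r"
    hence "s < dist x z"
      using that dist_triangle[of x y z] by linarith
    thus "ell2_fun (b (delta x \<xi>)) z = 0"
      by (rule bandD[OF b])
  qed
  thus ?thesis
    using assms[THEN band_bounded_ops] by (simp add: band_def bounded_ops_compose)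
qed

lemma band_dominated_compose:
  assumes "a \<in> band_dominated" "b \<in> band_dominated"
  shows "a o\<^sub>L b \<in> band_dominated"
  unfolding band_dominated_iff
proof (intro conjI allI impI)
  show "a o\<^sub>L b \<in> bounded_ops"
    using assms by (simp add: band_dominated_iff bounded_ops_compose)
  fix e :: real assume e: "0 < e"
  define M where "M = norm a + norm b + 1"
  have M: "0 < M" "norm a \<le> M" "norm b + 1 \<le> M"
    using norm_ge_zero[of a] norm_ge_zero[of b] unfolding M_def by linarith+
  \<comment> \<open>\<open>t \<le> 1\<close> bounds the norms of the approximants by \<open>M\<close>; then \<open>ab - cd = a (b - d) + (a - c) d\<close> costs
    at most \<open>2 t M\<close>.\<close>
  define t where "t = min 1 (e / (4 * M))"
  have t: "0 < t" "t \<le> 1" "t * M \<le> e / 4"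
    using e M(1) by (auto simp: t_def min_def field_simps)
  obtain r s c d where *: "c \<in> band r" "norm (a - c) < t" "d \<in> band s" "norm (b - d) < t"
    using assms t(1) unfolding band_dominated_iff by meson
  have d: "norm d \<le> M"
    using *(4) t(2) M(3) norm_triangle_ineq2[of d b] by (simp add: norm_minus_commute)
  have "norm ((a o\<^sub>L b) - (c o\<^sub>L d)) = norm ((a o\<^sub>L (b - d)) + ((a - c) o\<^sub>L d))"
    by (rule arg_cong[of _ _ norm], rule blinfun_eqI)
       (simp add: blinfun.diff_left blinfun.add_left blinfun.diff_right)
  also have "\<dots> \<le> norm a * norm (b - d) + norm (a - c) * norm d"
    by (intro norm_triangle_le add_mono norm_blinfun_compose)
  also have "\<dots> \<le> M * t + t * M"
    using * d M t by (intro add_mono mult_mono) simp_all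
  also have "\<dots> < e" using t(3) e by (simp add: mult.commute)
  finally have "norm ((a o\<^sub>L b) - (c o\<^sub>L d)) < e" .
  thus "\<exists>r. \<exists>c\<in>band r. norm ((a o\<^sub>L b) - c) < e"
    using band_compose[OF *(1,3)] by blast
qed

section \<open>Band-dominated operators are multipliers\<close>

lemma norm_entry_diff_le:
  assumes "a \<in> bounded_ops" "b \<in> bounded_ops"
  shows "norm (entry a x y - entry b x y) \<le> norm (a - b)"
proof (rule norm_blinfun_bound)
  fix \<xi>
  have "norm ((entry a x y - entry b x y) \<xi>) = norm (ell2_fun ((a - b) (delta x \<xi>)) y)"
    using assms by (simp add: blinfun.diff_left entry_apply ell2_fun_diff)
  also have "\<dots> \<le> norm ((a - b) (delta x \<xi>))"
    by (rule norm_ell2_fun_le)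
  also have "\<dots> \<le> norm (a - b) * norm \<xi>"
    using norm_blinfun[of "a - b" "delta x \<xi>"] by (simp add: norm_delta)
  finally show "norm ((entry a x y - entry b x y) \<xi>) \<le> norm (a - b) * norm \<xi>" .
qed simp

text \<open>Taking an entry is norm-decreasing, and the compact operators are closed.\<close>

lemma compact_entry_limit:
  fixes a :: "('x, 'h::chilbert_space) ell2 \<Rightarrow>\<^sub>L ('x, 'h) ell2"
  assumes a: "a \<in> bounded_ops"
    and lim: "\<And>e. 0 < e \<Longrightarrow> \<exists>c\<in>bounded_ops. compact_op (entry c x y) \<and> norm (a - c) \<le> e"
  shows "compact_op (entry a x y)"
proof (rule compact_op_limit)
  fix e :: real assume "0 < e"
  then obtain c where "c \<in> bounded_ops" "compact_op (entry c x y)" "norm (a - c) \<le> e"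
    using lim by blast
  thus "\<exists>k. compact_op k \<and> norm (entry a x y - k) \<le> e"
    using norm_entry_diff_le[OF a] order_trans by blast
qed

text \<open>
  In a product with an operator of finite propagation, matrix multiplication involves only the points
  of one ball. Balls being finite, an entry of the product is a finite sum of compact operators as
  soon as the other factor has compact entries.
\<close>

lemma entry_band_compose_left:
  assumes b: "b \<in> band r" and a: "a \<in> bounded_ops" and fin: "finite (cball y r)"
  shows "entry (b o\<^sub>L a) x y = (\<Sum>z\<in>cball y r. entry b z y o\<^sub>L entry a x z)"
proof (rule blinfun_eqI)
  fix \<xi>
  define f where "f = a (delta x \<xi>)"
  have b': "b \<in> bounded_ops" using b by (rule band_bounded_ops)
  have "ell2_fun (b (f - restr (cball y r) f)) y = 0"
    by (rule band_apply_eq_zero[OF b]) (simp add: ell2_fun_diff ell2_fun_restr dist_commute)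
  hence "ell2_fun (b f) y = ell2_fun (b (restr (cball y r) f)) y"
    by (simp add: blinfun.diff_right ell2_fun_diff)
  also have "\<dots> = (\<Sum>z\<in>cball y r. entry b z y (entry a x z \<xi>))"
    by (simp add: restr_finite[OF fin] blinfun.sum_right ell2_fun_sum entry_apply[OF b'] entry_apply[OF a] f_def)
  finally show "entry (b o\<^sub>L a) x y \<xi> = (\<Sum>z\<in>cball y r. entry b z y o\<^sub>L entry a x z) \<xi>"
    by (simp add: entry_apply[OF bounded_ops_compose[OF b' a]] blinfun.sum_left f_def)
qed

lemma entry_band_compose_right:
  assumes b: "b \<in> band r" and a: "a \<in> bounded_ops" and fin: "finite (cball x r)"
  shows "entry (a o\<^sub>L b) x y = (\<Sum>z\<in>cball x r. entry a z y o\<^sub>L entry b x z)"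
proof (rule blinfun_eqI)
  fix \<xi>
  define f where "f = b (delta x \<xi>)"
  have b': "b \<in> bounded_ops" using b by (rule band_bounded_ops)
  have "f = restr (cball x r) f"
    by (rule ell2_eqI) (simp add: ell2_fun_restr f_def bandD[OF b])
  hence "ell2_fun (a f) y = ell2_fun (a (restr (cball x r) f)) y"
    by (rule arg_cong)
  also have "\<dots> = (\<Sum>z\<in>cball x r. entry a z y (entry b x z \<xi>))"
    by (simp add: restr_finite[OF fin] blinfun.sum_right ell2_fun_sum entry_apply[OF b'] entry_apply[OF a] f_def)
  finally show "entry (a o\<^sub>L b) x y \<xi> = (\<Sum>z\<in>cball x r. entry a z y o\<^sub>L entry b x z) \<xi>"
    by (simp add: entry_apply[OF bounded_ops_compose[OF a b']] blinfun.sum_left f_def)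
qed

lemma band_dominated_scaled_approx:
  assumes "b \<in> band_dominated" "0 < e"
  obtains r c where "c \<in> band r" "norm (b - c) * norm a \<le> e"
proof -
  have pos: "0 < norm a + 1" using norm_ge_zero[of a] by linarith
  hence "0 < e / (norm a + 1)" using assms(2) by simp
  then obtain r c where c: "c \<in> band r" "norm (b - c) < e / (norm a + 1)"
    using assms(1) unfolding band_dominated_iff by blast
  have "norm (b - c) * norm a \<le> (e / (norm a + 1)) * (norm a + 1)"
    using c(2) pos assms(2) by (intro mult_mono) simp_all
  also have "\<dots> = e" using pos by simp
  finally show thesis using c(1) that by blast
qed

text \<open>
  A product with the Roe algebra stays band-dominated. Its entries are compact when the multiplier has
  finite propagation, and they stay compact when passing to the norm limit.
\<close>

theorem band_dominated_subset_multiplier_algebra: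
  fixes b :: "('x::metric_space, 'h::chilbert_space) ell2 \<Rightarrow>\<^sub>L ('x, 'h) ell2"
  assumes fin: "\<And>(x::'x) r. finite (cball x r)" and b: "b \<in> band_dominated"
  shows "b \<in> multiplier_algebra roe_algebra"
proof -
  have b': "b \<in> bounded_ops" using b by (simp add: band_dominated_iff)
  have "b o\<^sub>L a \<in> roe_algebra" "a o\<^sub>L b \<in> roe_algebra" if a: "a \<in> roe_algebra" for a
  proof -
    have aB: "a \<in> band_dominated" and aK: "\<And>x y. compact_op (entry a x y)"
      using a by (simp_all add: roe_algebra_def)
    have a': "a \<in> bounded_ops" using aB by (simp add: band_dominated_iff)
    have "compact_op (entry (b o\<^sub>L a) x y)" for x y
    proof (rule compact_entry_limit[OF bounded_ops_compose[OF b' a']])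
      fix e :: real assume "0 < e"
      then obtain r c where c: "c \<in> band r" "norm (b - c) * norm a \<le> e"
        using band_dominated_scaled_approx[OF b] by metis
      have "norm ((b o\<^sub>L a) - (c o\<^sub>L a)) \<le> e"
        using norm_blinfun_compose[of "b - c" a] c(2) by (simp add: blinfun_compose_diff)
      moreover have "compact_op (entry (c o\<^sub>L a) x y)"
        unfolding entry_band_compose_left[OF c(1) a' fin]
        by (intro compact_op_sum compact_op_compose_left aK)
      ultimately show "\<exists>d\<in>bounded_ops. compact_op (entry d x y) \<and> norm ((b o\<^sub>L a) - d) \<le> e"
        using bounded_ops_compose[OF band_bounded_ops[OF c(1)] a'] by blast
    qed
    thus "b o\<^sub>L a \<in> roe_algebra"
      using band_dominated_compose[OF b aB] by (simp add: roe_algebra_def)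
    have "compact_op (entry (a o\<^sub>L b) x y)" for x y
    proof (rule compact_entry_limit[OF bounded_ops_compose[OF a' b']])
      fix e :: real assume "0 < e"
      then obtain r c where c: "c \<in> band r" "norm (b - c) * norm a \<le> e"
        using band_dominated_scaled_approx[OF b] by metis
      have "norm ((a o\<^sub>L b) - (a o\<^sub>L c)) \<le> e"
        using norm_blinfun_compose[of a "b - c"] c(2) by (simp add: blinfun_compose_diff mult.commute)
      moreover have "compact_op (entry (a o\<^sub>L c) x y)"
        unfolding entry_band_compose_right[OF c(1) a' fin]
        by (intro compact_op_sum compact_op_compose_right aK)
      ultimately show "\<exists>d\<in>bounded_ops. compact_op (entry d x y) \<and> norm ((a o\<^sub>L b) - d) \<le> e"
        using bounded_ops_compose[OF a' band_bounded_ops[OF c(1)]] by blast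
    qed
    thus "a o\<^sub>L b \<in> roe_algebra"
      using band_dominated_compose[OF aB b] by (simp add: roe_algebra_def)
  qed
  thus ?thesis using b' by (simp add: multiplier_algebra_def)
qed

section \<open>Multipliers are band-dominated\<close>

lemma diag_op_in_roe_algebra:
  fixes k :: "'x::metric_space \<Rightarrow> ('h::complex_inner \<Rightarrow>\<^sub>L 'h)"
  assumes k: "\<And>x. compact_contraction (k x)"
  shows "diag_op k \<in> roe_algebra"
proof -
  have c: "contractions k" using k by (rule contractions_if_compact)
  have "entry (diag_op k) x y = (if x = y then k x else 0)" for x y
    using c by (auto intro!: blinfun_eqI simp: entry_apply diag_op_bounded_ops diag_op_delta ell2_fun_delta)
  moreover have "diag_op k \<in> band_dominated"
    using diag_op_in_band[OF c order_refl] by (rule band_subset_band_dominated)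
  ultimately show ?thesis
    using k by (simp add: roe_algebra_def compact_contraction_def compact_op_zero)
qed

text \<open>
  If a property can be achieved, for every \<open>n\<close>, by a diagonal family of compact contractions supported
  on a finite set that avoids any prescribed finite set, then a single family achieves all the
  properties at once, each on one of its disjoint finite blocks. Disjointness is what makes the
  blockwise sum of the chosen families again a family of contractions.
\<close>

lemma gliding_hump:
  fixes Q :: "nat \<Rightarrow> ('x \<Rightarrow> ('h::complex_inner \<Rightarrow>\<^sub>L 'h)) \<Rightarrow> bool"
  assumes step: "\<And>F n. finite F \<Longrightarrow>
    \<exists>G k. finite G \<and> G \<inter> F = {} \<and> (\<forall>x. compact_contraction (k x)) \<and> Q n (cut G k)"
  obtains k G where "\<And>x. compact_contraction (k x)" "disjoint_family G" "\<And>n. Q n (cut (G n) k)"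
proof -
  \<comment> \<open>A state \<open>(U, G, k)\<close> holds the current block \<open>G\<close>, its family \<open>k\<close>, and the union \<open>U\<close> of all blocks
    chosen so far, which the next block has to avoid.\<close>
  define P where "P n s = (case s of (U, G, k) \<Rightarrow>
    finite U \<and> G \<subseteq> U \<and> (\<forall>x. compact_contraction (k x)) \<and> Q n (cut G k))"
    for n and s :: "'x set \<times> 'x set \<times> ('x \<Rightarrow> ('h \<Rightarrow>\<^sub>L 'h))"
  define R where "R n s t = (case s of (U, G, k) \<Rightarrow> case t of (U', G', k') \<Rightarrow>
    U \<subseteq> U' \<and> G' \<inter> U = {})"
    for n :: nat and s t :: "'x set \<times> 'x set \<times> ('x \<Rightarrow> ('h \<Rightarrow>\<^sub>L 'h))"
  have "\<exists>f. \<forall>n. P n (f n) \<and> R n (f n) (f (Suc n))"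
  proof (rule dependent_nat_choice)
    obtain G k where "finite G" "\<forall>x. compact_contraction (k x)" "Q 0 (cut G k)"
      using step[of "{}" 0] by auto
    hence "P 0 (G, G, k)" by (simp add: P_def)
    thus "\<exists>s. P 0 s" ..
  next
    fix s n assume "P n s"
    then obtain U H h where s: "s = (U, H, h)" "finite U"
      by (auto simp: P_def)
    obtain G k where "finite G" "G \<inter> U = {}" "\<forall>x. compact_contraction (k x)" "Q (Suc n) (cut G k)"
      using step[OF s(2), of "Suc n"] by auto
    hence "P (Suc n) (U \<union> G, G, k) \<and> R n s (U \<union> G, G, k)"
      using s by (auto simp: P_def R_def)
    thus "\<exists>t. P (Suc n) t \<and> R n s t" ..
  qed
  then obtain f where f: "\<And>n. P n (f n)" "\<And>n. R n (f n) (f (Suc n))" by blast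
  define U where "U n = fst (f n)" for n
  define G where "G n = fst (snd (f n))" for n
  define K where "K n = snd (snd (f n))" for n
  have G: "G n \<subseteq> U n" and K: "compact_contraction (K n x)" and Q: "Q n (cut (G n) (K n))" for n x
    using f(1)[of n] by (auto simp: P_def U_def G_def K_def split_beta)
  have US: "U n \<subseteq> U (Suc n)" and GU: "G (Suc n) \<inter> U n = {}" for n
    using f(2)[of n] by (auto simp: R_def U_def G_def split_beta)
  have U: "U m \<subseteq> U n" if "m \<le> n" for m n
    using lift_Suc_mono_le[of U, OF US that] .
  have less: "G m \<inter> G n = {}" if mn: "m < n" for m n
  proof -
    obtain j where j: "n = Suc j" "m \<le> j" using mn by (cases n) auto
    show ?thesis using G[of m] U[OF j(2)] GU[of j] by (auto simp: j(1))
  qed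
  have disj: "m = n" if "x \<in> G m" "x \<in> G n" for x m n
    using less[of m n] less[of n m] that by (metis disjoint_iff linorder_neqE_nat)
  define k where "k x = (if \<exists>n. x \<in> G n then K (THE n. x \<in> G n) x else 0)" for x
  have k: "k x = K n x" if "x \<in> G n" for x n
  proof -
    have "(THE n. x \<in> G n) = n" by (rule the_equality) (use that disj in auto)
    thus ?thesis using that by (auto simp: k_def)
  qed
  show thesis
  proof (rule that)
    show "compact_contraction (k x)" for x
      by (simp add: k_def K compact_contraction_zero)
    show "disjoint_family G"
      using disj by (auto simp: disjoint_family_on_def)
    have "cut (G n) k = cut (G n) (K n)" for n
      by (auto simp: cut_def k)
    thus "Q n (cut (G n) k)" for n
      using Q by simp
  qed
qed

lemma disjoint_family_avoids_finite:
  fixes G :: "nat \<Rightarrow> 'x set"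
  assumes "disjoint_family G" "finite B"
  obtains n where "G n \<inter> B = {}"
proof (rule ccontr)
  assume "\<not> thesis"
  hence "\<forall>n. \<exists>x. x \<in> G n \<and> x \<in> B" using that by blast
  then obtain f where f: "\<And>n. f n \<in> G n" "\<And>n. f n \<in> B" by metis
  have "inj f"
  proof (rule injI, rule ccontr)
    fix m n assume "f m = f n" "m \<noteq> n"
    thus False
      using disjoint_family_onD[OF assms(1), of m n] f(1)[of m] f(1)[of n] by auto
  qed
  hence "infinite (range f)"
    using finite_imageD infinite_UNIV_nat by metis
  moreover have "range f \<subseteq> B"
    using f(2) by (auto simp: image_subset_iff)
  ultimately show False
    using assms(2) infinite_super by metis
qed

lemma not_band_dominated_iff:
  "a \<in> bounded_ops \<Longrightarrow> a \<notin> band_dominated \<longleftrightarrow> (\<exists>e>0. \<forall>r. \<forall>c\<in>band r. e \<le> norm (a - c))"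
  by (simp add: band_dominated_iff not_less)

text \<open>
  Testing on the left controls columns. If the column of \<open>b\<close> at \<open>x\<close> is not band-dominated, then a
  definite part of its norm remains outside every finite set, since the part inside has finite
  propagation. Hence disjoint finite blocks, each with a diagonal family of compact contractions,
  still see norm greater than \<open>e / 2\<close> in the column. For their common family \<open>k\<close>, the operator
  \<open>diag_op k o\<^sub>L b\<close> is not band-dominated: the column at \<open>x\<close> of an operator of finite propagation lives
  in a finite ball, which misses one of the blocks.
\<close>

lemma column_band_dominated:
  fixes b :: "('x::metric_space, 'h::complex_inner) ell2 \<Rightarrow>\<^sub>L ('x, 'h) ell2"
  assumes fin: "\<And>(x::'x) r. finite (cball x r)" and b: "b \<in> bounded_ops"
    and mult: "\<And>k. (\<And>x. compact_contraction (k x)) \<Longrightarrow> diag_op k o\<^sub>L b \<in> band_dominated"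
  shows "b o\<^sub>L restr {x} \<in> band_dominated"
proof (rule ccontr)
  define v where "v = b o\<^sub>L restr {x}"
  have vB: "v \<in> bounded_ops"
    unfolding v_def by (intro bounded_ops_compose b restr_bounded_ops)
  have v_delta: "v (delta z \<xi>) = 0" if "z \<noteq> x" for z \<xi>
    using that by (simp add: v_def restr_delta blinfun.zero_right)
  assume "b o\<^sub>L restr {x} \<notin> band_dominated"
  hence "v \<notin> band_dominated" by (simp only: v_def not_False_eq_True)
  then obtain e where e: "0 < e" "\<And>r c. c \<in> band r \<Longrightarrow> e \<le> norm (v - c)"
    unfolding not_band_dominated_iff[OF vB] by auto
  have hump: "\<exists>G k. finite G \<and> G \<inter> F = {} \<and> (\<forall>x. compact_contraction (k x)) \<and>
      e / 2 < norm (diag_op (cut G k) o\<^sub>L v)" if F: "finite F" for F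
  proof -
    obtain r where "\<forall>y\<in>F. dist x y \<le> r"
      using finite_imp_bounded[OF F] unfolding bounded_any_center[of F x] by blast
    hence r: "F \<subseteq> cball x r" by auto
    have "restr F o\<^sub>L v \<in> band r"
      unfolding band_def
    proof (intro CollectI conjI allI impI)
      show "restr F o\<^sub>L v \<in> bounded_ops"
        by (intro bounded_ops_compose vB restr_bounded_ops)
      fix z y :: 'x and \<xi> :: 'h assume "r < dist z y"
      thus "ell2_fun ((restr F o\<^sub>L v) (delta z \<xi>)) y = 0"
        using r v_delta[of z \<xi>] by (cases "z = x") (auto simp: ell2_fun_restr ell2_fun_zero)
    qed
    hence "e \<le> norm (v - (restr F o\<^sub>L v))" by (rule e(2))
    have "\<exists>f. e / 2 * norm f < norm ((v - (restr F o\<^sub>L v)) f)"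
    proof (rule ccontr)
      assume "\<not> ?thesis"
      hence "norm (v - (restr F o\<^sub>L v)) \<le> e / 2"
        using e(1) by (intro norm_blinfun_bound) (auto simp: not_less)
      thus False using \<open>e \<le> _\<close> e(1) by linarith
    qed
    then obtain f where f: "e / 2 * norm f < norm ((v - (restr F o\<^sub>L v)) f)" ..
    define w where "w = v f - restr F (v f)"
    have "0 < norm w - e / 2 * norm f"
      using f by (simp add: w_def blinfun.diff_left)
    then obtain E where E: "finite E" "norm (w - restr E w) < norm w - e / 2 * norm f"
      using restr_tail_small[of "norm w - e / 2 * norm f" w] by blast
    define G where "G = E - F"
    have "restr E w = restr G (v f)"
      by (rule ell2_eqI) (auto simp: w_def G_def ell2_fun_restr ell2_fun_diff ell2_fun_zero)
    hence large: "e / 2 * norm f < norm (restr G (v f))"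
      using E(2) norm_triangle_ineq2[of w "restr E w"] by simp
    have "\<exists>p. compact_contraction p \<and> p u = u" for u :: 'h
      using finite_set_fixed_by_compact_contraction[of "{u}"] by blast
    then obtain p :: "'h \<Rightarrow> ('h \<Rightarrow>\<^sub>L 'h)" where p: "\<And>u. compact_contraction (p u)" "\<And>u. p u u = u"
      by metis
    define k where "k y = p (ell2_fun (v f) y)" for y
    have k: "\<And>y. compact_contraction (k y)" by (simp add: k_def p(1))
    have "diag_op (cut G k) (v f) = restr G (v f)"
      by (rule ell2_eqI)
         (simp add: ell2_fun_diag_op contractions_cut contractions_if_compact k ell2_fun_restr,
          simp add: cut_def k_def p(2))
    hence "e / 2 * norm f < norm ((diag_op (cut G k) o\<^sub>L v) f)"
      using large by simp
    also have "\<dots> \<le> norm (diag_op (cut G k) o\<^sub>L v) * norm f"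
      by (rule norm_blinfun)
    finally have "e / 2 < norm (diag_op (cut G k) o\<^sub>L v)"
      by (rule mult_right_less_imp_less) simp
    moreover have "finite G" "G \<inter> F = {}"
      using E(1) by (auto simp: G_def)
    ultimately show ?thesis using k by blast
  qed
  obtain k G where k: "\<And>x. compact_contraction (k x)" and G: "disjoint_family G"
    and large: "\<And>n::nat. e / 2 < norm (diag_op (cut (G n) k) o\<^sub>L v)"
    using gliding_hump[of "\<lambda>_ k. e / 2 < norm (diag_op k o\<^sub>L v)", OF hump] by metis
  obtain r c where c: "c \<in> band r" "norm ((diag_op k o\<^sub>L b) - c) < e / 2"
    using mult[of k, OF k] e(1) unfolding band_dominated_iff by (meson half_gt_zero)
  obtain n where n: "G n \<inter> cball x r = {}"
    using disjoint_family_avoids_finite[OF G fin] by blast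
  have "restr (G n) (c (restr {x} f)) = 0" for f
    by (rule ell2_eqI) (use n in \<open>auto simp: restr_singleton ell2_fun_restr ell2_fun_zero intro!: bandD[OF c(1)]\<close>)
  hence "restr (G n) o\<^sub>L (((diag_op k o\<^sub>L b) - c) o\<^sub>L restr {x}) = restr (G n) o\<^sub>L diag_op k o\<^sub>L v"
    by (intro blinfun_eqI) (simp add: v_def blinfun.diff_left blinfun.diff_right)
  also have "\<dots> = diag_op (cut (G n) k) o\<^sub>L v"
    by (simp add: restr_diag_op contractions_if_compact k)
  finally have eq: "diag_op (cut (G n) k) o\<^sub>L v = restr (G n) o\<^sub>L (((diag_op k o\<^sub>L b) - c) o\<^sub>L restr {x})"
    by (rule sym)
  have "norm (diag_op (cut (G n) k) o\<^sub>L v) \<le> norm (((diag_op k o\<^sub>L b) - c) o\<^sub>L restr {x})"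
    unfolding eq by (rule norm_compose_contraction_left[OF norm_restr_le])
  also have "\<dots> \<le> norm ((diag_op k o\<^sub>L b) - c)"
    by (rule norm_compose_contraction_right[OF norm_restr_le])
  finally have "norm (diag_op (cut (G n) k) o\<^sub>L v) \<le> norm ((diag_op k o\<^sub>L b) - c)" .
  thus False using large[of n] c(2) by linarith
qed

lemma finite_columns_band_dominated:
  fixes b :: "('x::metric_space, 'h::complex_inner) ell2 \<Rightarrow>\<^sub>L ('x, 'h) ell2"
  assumes "\<And>(x::'x) r. finite (cball x r)" "b \<in> bounded_ops"
    "\<And>k. (\<And>x. compact_contraction (k x)) \<Longrightarrow> diag_op k o\<^sub>L b \<in> band_dominated"
    and F: "finite F"
  shows "b o\<^sub>L restr F \<in> band_dominated"
  using F
proof induction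
  case empty
  have "b o\<^sub>L restr {} = 0"
    by (rule blinfun_eqI) (simp add: restr_empty blinfun.zero_right)
  thus ?case using band_subset_band_dominated[OF band_zero[of 0]] by simp
next
  case (insert x F)
  have "restr (insert x F) = restr {x} + (restr F :: ('x, 'h) ell2 \<Rightarrow>\<^sub>L ('x, 'h) ell2)"
    using insert.hyps restr_Un_disjoint[of "{x}" F] by simp
  hence "b o\<^sub>L restr (insert x F) = (b o\<^sub>L restr {x}) + (b o\<^sub>L restr F)"
    by (intro blinfun_eqI) (simp add: blinfun.add_left blinfun.add_right)
  thus ?case
    using column_band_dominated[OF assms(1-3)] insert.IH by (simp add: band_dominated_add)
qed

text \<open>
  The distance to the operators of propagation at most \<open>r\<close> is determined by the finite-rank cuts
  \<open>a D\<close>. There is a net of such contractions \<open>D S\<close>, indexed by finite sets \<open>S\<close> of pairs of a point and a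
  vector to be fixed in its fibre, that converges strongly to the identity. The approximants of
  \<open>a D S\<close> are bounded, so they cluster weakly at an operator. Propagation at most \<open>r\<close> and distance at
  most \<open>e\<close> are conditions on matrix coefficients and survive in the limit; norm convergence of the
  \<open>a D S\<close> to \<open>a\<close> is not to be expected.
\<close>

lemma band_approximation_from_finite_cuts:
  fixes a :: "('x::metric_space, 'h::chilbert_space) ell2 \<Rightarrow>\<^sub>L ('x, 'h) ell2"
  assumes a: "a \<in> bounded_ops"
    and approx: "\<And>G k. finite G \<Longrightarrow> (\<And>x. compact_contraction (k x)) \<Longrightarrow>
      \<exists>c\<in>band r. norm ((a o\<^sub>L diag_op (cut G k)) - c) \<le> e"
  shows "\<exists>c\<in>band r. norm (a - c) \<le> e"
proof -
  have "\<forall>S::'h set. \<exists>p. finite S \<longrightarrow> compact_contraction p \<and> (\<forall>v\<in>S. blinfun_apply p v = v)"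
    using finite_set_fixed_by_compact_contraction by metis
  then obtain p :: "'h set \<Rightarrow> ('h \<Rightarrow>\<^sub>L 'h)" where
    p: "\<And>S. finite S \<Longrightarrow> compact_contraction (p S)" "\<And>S v. finite S \<Longrightarrow> v \<in> S \<Longrightarrow> p S v = v"
    by metis
  \<comment> \<open>A default value for infinite \<open>S\<close>, so that the norm bounds below hold for every index.\<close>
  define k where "k S x = (if finite S then p {\<xi>. (x, \<xi>) \<in> S} else 0)" for S :: "('x \<times> 'h) set" and x
  have fib: "finite {\<xi>. (x, \<xi>) \<in> S}" if "finite S" for S :: "('x \<times> 'h) set" and x
    by (rule finite_subset[OF _ finite_imageI[OF that, of snd]]) force
  have k: "compact_contraction (k S x)" for S x
    by (simp add: k_def p(1) fib compact_contraction_zero)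
  define D where "D S = diag_op (cut (if finite S then fst ` S else {}) (k S))" for S
  have cD: "contractions (cut A (k S))" for A S
    by (intro contractions_cut contractions_if_compact k)
  have D: "ell2_fun (D S f) x = ell2_fun f x" if "finite S" "(x, ell2_fun f x) \<in> S" for S f x
  proof -
    have "x \<in> fst ` S" using that(2) by force
    hence "ell2_fun (D S f) x = k S x (ell2_fun f x)"
      using that(1) by (simp add: D_def ell2_fun_diag_op[OF cD]) (simp add: cut_def)
    also have "\<dots> = ell2_fun f x"
      using that by (simp add: k_def p(2) fib)
    finally show ?thesis .
  qed
  have D_norm: "norm (D S f) \<le> norm f" "norm (D S) \<le> 1" "D S \<in> bounded_ops" for S f
    by (simp_all add: D_def norm_diag_op_apply_le norm_diag_op_le diag_op_bounded_ops cD)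
  have strong: "((\<lambda>S. D S f) \<longlongrightarrow> f) (finite_subsets_at_top UNIV)" for f
  proof (rule tendstoI)
    fix t :: real assume "0 < t"
    then obtain F where F: "finite F" "norm (f - restr F f) < t / 2"
      using restr_tail_small[of "t / 2" f] by auto
    have "dist (D S f) f < t" if S: "finite S" "(\<lambda>x. (x, ell2_fun f x)) ` F \<subseteq> S" for S
    proof -
      define g where "g = f - restr F f"
      \<comment> \<open>On \<open>F\<close> both sides vanish, as \<open>D S\<close> fixes the values of \<open>f\<close> there; off \<open>F\<close> the vectors agree.\<close>
      have "D S f - f = D S g - g"
      proof (rule ell2_eqI)
        fix x
        show "ell2_fun (D S f - f) x = ell2_fun (D S g - g) x"
        proof (cases "x \<in> F")
          case True
          hence "ell2_fun (D S f) x = ell2_fun f x" using S by (intro D) auto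
          moreover have "ell2_fun g x = 0" using True by (simp add: g_def ell2_fun_diff ell2_fun_restr)
          moreover from this have "ell2_fun (D S g) x = 0"
            by (simp add: D_def ell2_fun_diag_op[OF cD] blinfun.zero_right)
          ultimately show ?thesis by (simp add: ell2_fun_diff)
        next
          case False
          hence "ell2_fun g x = ell2_fun f x" by (simp add: g_def ell2_fun_diff ell2_fun_restr)
          thus ?thesis by (simp add: ell2_fun_diff D_def ell2_fun_diag_op[OF cD])
        qed
      qed
      hence "dist (D S f) f \<le> norm (D S g) + norm g"
        by (simp add: dist_norm norm_triangle_ineq4)
      thus ?thesis using D_norm(1)[of S g] F(2) by (simp add: g_def)
    qed
    thus "\<forall>\<^sub>F S in finite_subsets_at_top UNIV. dist (D S f) f < t"
      unfolding eventually_finite_subsets_at_top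
      using F(1) by (intro exI[of _ "(\<lambda>x. (x, ell2_fun f x)) ` F"]) simp
  qed
  have "\<exists>c\<in>band r. norm ((a o\<^sub>L D S) - c) \<le> e" for S
    unfolding D_def by (rule approx) (simp_all add: k)
  then obtain c where c: "\<And>S. c S \<in> band r" "\<And>S. norm ((a o\<^sub>L D S) - c S) \<le> e"
    by metis
  have e: "0 \<le> e" using c(2) norm_ge_zero order_trans by blast
  have "norm (c S) \<le> norm a + e" for S
    using norm_triangle_ineq2[of "c S" "a o\<^sub>L D S"] c(2)[of S]
      norm_compose_contraction_right[OF D_norm(2), of a S] by (simp add: norm_minus_commute)
  then obtain N L where N: "N \<noteq> bot" "N \<le> finite_subsets_at_top UNIV" and L: "L \<in> bounded_ops"
    and lim: "\<And>u v. ((\<lambda>S. cinner (c S u) v) \<longlongrightarrow> cinner (L u) v) N"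
    using bounded_net_weak_cluster_point[of "finite_subsets_at_top UNIV" c "norm a + e"]
      band_bounded_ops[OF c(1)] finite_subsets_at_top_neq_bot by metis
  have "L \<in> band r"
    unfolding band_def
  proof (intro CollectI conjI allI impI L)
    fix x y :: 'x and \<xi> :: 'h assume xy: "r < dist x y"
    define \<eta> where "\<eta> = ell2_fun (L (delta x \<xi>)) y"
    have "cinner (c S (delta x \<xi>)) (delta y \<eta>) = 0" for S
      using bandD[OF c(1) xy] by (simp add: cinner_delta_right)
    hence "cinner (L (delta x \<xi>)) (delta y \<eta>) = 0"
      using lim[of "delta x \<xi>" "delta y \<eta>"] tendsto_unique[OF N(1) _ tendsto_const] by simp
    thus "ell2_fun (L (delta x \<xi>)) y = 0"
      by (simp add: cinner_delta_right cinner_self flip: \<eta>_def)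
  qed
  moreover have "norm (a - L) \<le> e"
  proof (rule norm_blinfun_bound[OF e], rule norm_le_if_cinner_le)
    fix u v :: "('x, 'h) ell2"
    have cont: "bounded_linear (\<lambda>w. cinner w v)"
      by (rule bounded_linear_intro[where K = "norm v"])
         (simp_all add: cinner_add_left cinner_scaleC_left scaleR_conv_of_real cinner_Cauchy_Schwarz
            flip: scaleC_of_real)
    have "((\<lambda>S. cinner (a (D S u)) v) \<longlongrightarrow> cinner (a u) v) N"
      by (intro bounded_linear.tendsto[OF cont] bounded_linear.tendsto[OF blinfun.bounded_linear_right]
            tendsto_mono[OF N(2)] strong)
    from tendsto_diff[OF this lim]
    have "((\<lambda>S. cinner (((a o\<^sub>L D S) - c S) u) v) \<longlongrightarrow> cinner ((a - L) u) v) N"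
      by (simp add: blinfun.diff_left cinner_diff_left)
    moreover have "cmod (cinner (((a o\<^sub>L D S) - c S) u) v) \<le> e * norm u * norm v" for S
    proof -
      have "norm (((a o\<^sub>L D S) - c S) u) \<le> e * norm u"
        using norm_blinfun[of "(a o\<^sub>L D S) - c S" u] mult_right_mono[OF c(2)[of S] norm_ge_zero[of u]]
        by linarith
      from mult_right_mono[OF this norm_ge_zero[of v]] show ?thesis
        using cinner_Cauchy_Schwarz[of "((a o\<^sub>L D S) - c S) u" v] by linarith
    qed
    ultimately show "cmod (cinner ((a - L) u) v) \<le> e * norm u * norm v"
      using Lim_norm_ubound[OF N(1) _ always_eventually] by blast
  qed (use e in simp)
  ultimately show ?thesis by blast
qed

text \<open>
  Testing on the right. Let \<open>b\<close> have distance at least \<open>e\<close> from all operators of finite propagation.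
  Finitely many columns of \<open>b\<close> are band-dominated, so deleting them keeps the distance above \<open>e / 2\<close>,
  and by weak compactness some finite-rank cut supported on the remaining columns has distance
  greater than \<open>e / 4\<close> from the operators of propagation at most \<open>n\<close>. The gliding hump collects such
  cuts for all \<open>n\<close> into one diagonal element \<open>diag_op k\<close> of the Roe algebra. Restricting to the block of
  \<open>n\<close> does not increase propagation or norm, so \<open>b o\<^sub>L diag_op k\<close> is not band-dominated.
\<close>

theorem multiplier_algebra_subset_band_dominated:
  fixes b :: "('x::metric_space, 'h::chilbert_space) ell2 \<Rightarrow>\<^sub>L ('x, 'h) ell2"
  assumes fin: "\<And>(x::'x) r. finite (cball x r)" and mult: "b \<in> multiplier_algebra roe_algebra"
  shows "b \<in> band_dominated"
proof (rule ccontr)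
  have b: "b \<in> bounded_ops"
    using mult by (simp add: multiplier_algebra_def)
  have left: "diag_op k o\<^sub>L b \<in> band_dominated" and right: "b o\<^sub>L diag_op k \<in> band_dominated"
    if "\<And>x. compact_contraction (k x)" for k
    using mult diag_op_in_roe_algebra[of k, OF that] by (simp_all add: multiplier_algebra_def roe_algebra_def)
  assume "b \<notin> band_dominated"
  then obtain e where e: "0 < e" "\<And>r c. c \<in> band r \<Longrightarrow> e \<le> norm (b - c)"
    unfolding not_band_dominated_iff[OF b] by auto
  have hump: "\<exists>G k. finite G \<and> G \<inter> F = {} \<and> (\<forall>x. compact_contraction (k x)) \<and>
      (\<forall>c\<in>band (real n). e / 4 < norm ((b o\<^sub>L diag_op (cut G k)) - c))" if F: "finite F" for F n
  proof (rule ccontr)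
    assume neg: "\<not> ?thesis"
    obtain s d where d: "d \<in> band s" "norm ((b o\<^sub>L restr F) - d) < e / 4"
      using finite_columns_band_dominated[OF fin b left F] e(1)
      unfolding band_dominated_iff by (meson divide_pos_pos zero_less_numeral)
    \<comment> \<open>If no such cut existed, \<open>b\<close> would be closer than \<open>e\<close> to the sum of \<open>d\<close> and an approximant \<open>c\<close> of
      the remaining columns.\<close>
    have "\<exists>c\<in>band (real n). norm ((b o\<^sub>L restr (- F)) - c) \<le> e / 4"
    proof (rule band_approximation_from_finite_cuts)
      show "b o\<^sub>L restr (- F) \<in> bounded_ops"
        by (intro bounded_ops_compose b restr_bounded_ops)
      fix G :: "'x set" and k :: "'x \<Rightarrow> ('h \<Rightarrow>\<^sub>L 'h)"
      assume G: "finite G" and k: "\<And>x. compact_contraction (k x)"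
      have "restr (- F) o\<^sub>L diag_op (cut G k) = diag_op (cut (- F) (cut G k))"
        by (intro restr_diag_op contractions_cut contractions_if_compact k)
      also have "cut (- F) (cut G k) = cut (G - F) k"
        by (auto simp: cut_def)
      finally have *: "(b o\<^sub>L restr (- F)) o\<^sub>L diag_op (cut G k) = b o\<^sub>L diag_op (cut (G - F) k)"
        by (simp only: blinfun_compose_assoc)
      have "finite (G - F)" "(G - F) \<inter> F = {}"
        using G by auto
      hence "\<not> (\<forall>c\<in>band (real n). e / 4 < norm ((b o\<^sub>L diag_op (cut (G - F) k)) - c))"
        using neg k by blast
      hence "\<exists>c\<in>band (real n). norm ((b o\<^sub>L diag_op (cut (G - F) k)) - c) \<le> e / 4"
        by (auto simp: not_less)
      thus "\<exists>c\<in>band (real n). norm (((b o\<^sub>L restr (- F)) o\<^sub>L diag_op (cut G k)) - c) \<le> e / 4"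
        unfolding * .
    qed
    then obtain c where c: "c \<in> band (real n)" "norm ((b o\<^sub>L restr (- F)) - c) \<le> e / 4" ..
    have cd: "c + d \<in> band (max (real n) s)"
      by (intro band_add band_mono[OF c(1)] band_mono[OF d(1)]) auto
    have eq: "b - (c + d) = ((b o\<^sub>L restr (- F)) - c) + ((b o\<^sub>L restr F) - d)"
    proof (rule blinfun_eqI)
      fix f :: "('x, 'h) ell2"
      have "restr (- F) f + restr F f = f"
        by (rule ell2_eqI) (simp add: ell2_fun_add ell2_fun_restr)
      hence "b f = b (restr (- F) f) + b (restr F f)"
        by (simp flip: blinfun.add_right)
      thus "(b - (c + d)) f = (((b o\<^sub>L restr (- F)) - c) + ((b o\<^sub>L restr F) - d)) f"
        by (simp add: blinfun.diff_left blinfun.add_left)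
    qed
    have "e \<le> norm (((b o\<^sub>L restr (- F)) - c) + ((b o\<^sub>L restr F) - d))"
      using e(2)[OF cd] by (simp only: eq)
    thus False
      using norm_triangle_ineq[of "(b o\<^sub>L restr (- F)) - c" "(b o\<^sub>L restr F) - d"] c(2) d(2) e(1)
      by linarith
  qed
  obtain k G where k: "\<And>x. compact_contraction (k x)" 
    and far: "\<And>n c. c \<in> band (real n) \<Longrightarrow> e / 4 < norm ((b o\<^sub>L diag_op (cut (G n) k)) - c)"
    using gliding_hump[of "\<lambda>n k. \<forall>c\<in>band (real n). e / 4 < norm ((b o\<^sub>L diag_op k) - c)", OF hump]
    by metis
  obtain r c where c: "c \<in> band r" "norm ((b o\<^sub>L diag_op k) - c) < e / 4"
    using right[of k, OF k] e(1) unfolding band_dominated_iff by (meson divide_pos_pos zero_less_numeral)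
  obtain n :: nat where n: "r \<le> real n"
    using real_arch_simple by blast
  have "restr (G n) \<in> band 0"
    unfolding restr_def by (intro diag_op_in_band contractions_cut contractions_id order_refl)
  from band_compose[OF c(1) this] have "c o\<^sub>L restr (G n) \<in> band (real n)"
    by (rule band_mono) (simp add: n)
  hence "e / 4 < norm ((b o\<^sub>L diag_op (cut (G n) k)) - (c o\<^sub>L restr (G n)))"
    by (rule far)
  also have "(b o\<^sub>L diag_op (cut (G n) k)) - (c o\<^sub>L restr (G n))
      = ((b o\<^sub>L diag_op k) - c) o\<^sub>L restr (G n)"
    unfolding restr_diag_op(2)[OF contractions_if_compact[of k, OF k], symmetric]
    by (simp add: blinfun_compose_diff blinfun_compose_assoc)
  also have "norm \<dots> \<le> norm ((b o\<^sub>L diag_op k) - c)"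
    by (intro norm_compose_contraction_right norm_restr_le)
  finally show False using c(2) by linarith
qed

theorem theorem4p1:
  assumes "uniformly_locally_finite TYPE('x::metric_space)"
    and "separable_space (euclidean :: 'h::chilbert_space topology)"
    and "infinite_dimensional TYPE('h)"
  shows "(band_dominated :: (('x, 'h) ell2 \<Rightarrow>\<^sub>L ('x, 'h) ell2) set) = multiplier_algebra roe_algebra"
proof -
  have fin: "finite (cball x r)" for x :: 'x and r
  proof -
    have "finite (cball x (max r 1))"
      using assms(1) unfolding uniformly_locally_finite_def
      by (metis less_max_iff_disj zero_less_one)
    thus ?thesis by (rule rev_finite_subset) auto
  qed
  show ?thesis
    using band_dominated_subset_multiplier_algebra[OF fin]
      multiplier_algebra_subset_band_dominated[OF fin] by blast
qed

end
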